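(* Define a random sequence of graphs $G^{\rm ra}_n$ as follows: start with a single node labeled $0$. At the $n$-th iteration ($n=1,2,\dots$) a new node labeled $n$ is born, it is joined to each existing node $i$ independently with probability $1-i/n$, and then every pair of nonadjacent nodes is joined independently with probability $\min(1,2/n)$; $G^{\rm ra}_n$ denotes the graph obtained after the $n$-th iteration. Then with probability $1$, $t(F,G^{\rm ra}_n)\to t(F,W)$ for every finite simple graph $F$, where $W(x,y)=1-xy$ on $[0,1]^2$.
   Context: For finite simple graphs $F,G$, $t(F,G)=\hom(F,G)/|V(G)|^{|V(F)|}$, where $\hom(F,G)$ is the number of adjacency-preserving maps $V(F)\to V(G)$. For a bounded symmetric measurable $W:[0,1]^2\to\mathbb{R}$, $t(F,W)=\int_{[0,1]^{V(F)}}\prod_{ij\in E(F)}W(x_i,x_j)\,dx$. *)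

theory Defs
  imports "HOL-Probability.Probability"
begin

record 'v graph =
  verts :: "'v set"
  edges :: "'v set set"

definition vertex_pairs :: "'v set \<Rightarrow> 'v set set" where
  "vertex_pairs V = {e. e \<subseteq> V \<and> card e = 2}"

definition finite_simple_graph :: "'v graph \<Rightarrow> bool" where
  "finite_simple_graph F \<longleftrightarrow> finite (verts F) \<and> edges F \<subseteq> vertex_pairs (verts F)"

definition homs :: "'v graph \<Rightarrow> 'w graph \<Rightarrow> ('v \<Rightarrow> 'w) set" where
  "homs F G = {f \<in> verts F \<rightarrow>\<^sub>E verts G. \<forall>i j. {i, j} \<in> edges F \<longrightarrow> {f i, f j} \<in> edges G}"

definition hom_density :: "'v graph \<Rightarrow> 'w graph \<Rightarrow> real" where
  "hom_density F G = real (card (homs F G)) / real (card (verts G)) ^ card (verts F)"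

(* The value W (x i) (x j) on the unordered pair e = {i, j}; this is well defined
   because W is meant to be symmetric. *)
definition edge_value :: "(real \<Rightarrow> real \<Rightarrow> real) \<Rightarrow> ('v \<Rightarrow> real) \<Rightarrow> 'v set \<Rightarrow> real" where
  "edge_value W x e = (THE w. \<exists>i j. e = {i, j} \<and> w = W (x i) (x j))"

definition kernel_density :: "'v graph \<Rightarrow> (real \<Rightarrow> real \<Rightarrow> real) \<Rightarrow> real" where
  "kernel_density F W =
     (LINT x|(\<Pi>\<^sub>M i\<in>verts F. restrict_space lborel {0..1}). (\<Prod>e\<in>edges F. edge_value W x e))"

(* The conditional law of the graph after the n-th iteration, given that G is the graph
   before it.  Outside its index set a Pi_pmf sample is False, so b selects only pairs that
   are nonadjacent after the new node n has been attached. *)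
definition ra_step :: "nat \<Rightarrow> nat graph \<Rightarrow> nat graph pmf" where
  "ra_step n G =
     bind_pmf (Pi_pmf (verts G) False (\<lambda>i. bernoulli_pmf (1 - real i / real n))) (\<lambda>a.
       let V = insert n (verts G);
           E = edges G \<union> {{i, n} | i. i \<in> verts G \<and> a i}
       in map_pmf (\<lambda>b. \<lparr>verts = V, edges = E \<union> {e. b e}\<rparr>)
            (Pi_pmf (vertex_pairs V - E) False (\<lambda>_. bernoulli_pmf (min 1 (2 / real n)))))"

(* Any sequence of random graphs with the prescribed joint law: the Markov chain with
   transition probabilities ra_step, started at the one-node graph. *)
locale ra_graph_sequence = prob_space M
  for M :: "'a measure" and G :: "nat \<Rightarrow> 'a \<Rightarrow> nat graph" +
  assumes random_graph: "\<And>n. random_variable (count_space UNIV) (G n)"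
    and start: "AE \<omega> in M. G 0 \<omega> = \<lparr>verts = {0}, edges = {}\<rparr>"
    and iteration: "\<And>n g. prob {\<omega> \<in> space M. \<forall>k\<le>Suc n. G k \<omega> = g k} =
      prob {\<omega> \<in> space M. \<forall>k\<le>n. G k \<omega> = g k} * pmf (ra_step (Suc n) (g n)) (g (Suc n))"

end

theory Submission
  imports Defs "HOL-Real_Asymp.Real_Asymp"
begin

text \<open>
  A pair \<open>i < j\<close> survives as a nonadjacent pair up to iteration \<open>n\<close> with probability
  \<open>i/j (1 - 2/j) \<cdots> (1 - 2/n) = i/j (j - 1)(j - 2)/(n(n - 1))\<close>, which is close to \<open>(i/n)(j/n)\<close>, and
  different pairs are independent.  Hence the mean of \<open>t(F, G\<^sub>n)\<close> is a Riemann sum of \<open>t(F, W)\<close> up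
  to \<open>O(1/n)\<close>.  Two maps \<open>\<phi>, \<psi>\<close> from the nodes of \<open>F\<close> contribute to the variance only if their
  images share a pair, so the variance is \<open>O(1/n\<^sup>2)\<close>.  This is summable, which gives almost sure
  convergence for each \<open>F\<close>, and there are only countably many \<open>F\<close> up to isomorphism.
\<close>

subsection \<open>Random subsets with independent elements\<close>

text \<open>Almost sure convergence is drawn from second moments at single times. Dependence between
  graphs at different times is therefore harmless, and the chain enters the estimates only through
  the law of one graph. Identifying this law is the main obstacle: the hypotheses give path
  probabilities, and in every step the second round of coins is tossed on a random set of pairs.
  Independence of the pairs has to be carried through an induction on the iteration. The constant 2
  in \<open>2/n\<close> is what produces the kernel: attachment leaves the factor
  \<open>i/j\<close>, and the factors \<open>(k - 2)/k\<close> of the later rounds telescope to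
  about \<open>(j/n)^2\<close>, which turns \<open>i/j\<close> into the symmetric expression
  \<open>(i/n)(j/n)\<close>. A shared pair fixes two values of \<open>\<psi>\<close> once
  \<open>\<phi>\<close> is given, and each fixed value costs a factor of order \<open>n\<close>. The
  resulting variance can be summed along the full sequence, without passing to a subsequence. In the
  mean, maps that are not injective need separate care, because they may collapse an edge or merge
  two edges; they form a fraction of order \<open>1/n\<close>.\<close>

definition bernoulli_set :: "'a set \<Rightarrow> ('a \<Rightarrow> real) \<Rightarrow> 'a set pmf" where
  "bernoulli_set A p = map_pmf Collect (Pi_pmf A False (\<lambda>x. bernoulli_pmf (p x)))"

lemma bernoulli_set_empty [simp]: "bernoulli_set {} p = return_pmf {}"
  by (simp add: bernoulli_set_def)

lemma bernoulli_set_cong: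
  "A = B \<Longrightarrow> (\<And>x. x \<in> B \<Longrightarrow> p x = q x) \<Longrightarrow> bernoulli_set A p = bernoulli_set B q"
  unfolding bernoulli_set_def by (auto intro!: arg_cong[where f = "map_pmf Collect"] Pi_pmf_cong)

lemma bernoulli_set_insert:
  assumes "finite A" "x \<notin> A"
  shows "bernoulli_set (insert x A) p =
    bind_pmf (bernoulli_pmf (p x)) (\<lambda>b. map_pmf (\<lambda>S. if b then insert x S else S) (bernoulli_set A p))"
proof -
  have *: "Collect (f(x := b)) = (if b then insert x (Collect f) else Collect f)"
    if "f \<in> set_pmf (Pi_pmf A False (\<lambda>x. bernoulli_pmf (p x)))" for f b
    using subsetD[OF set_Pi_pmf_subset[OF assms(1)] that] assms(2) by (auto split: if_splits)
  show ?thesis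
    unfolding bernoulli_set_def Pi_pmf_insert'[OF assms] map_pmf_def bind_assoc_pmf bind_return_pmf
    by (intro bind_pmf_cong refl) (simp only: * split: if_splits)
qed

lemma bernoulli_set_subset:
  assumes "finite A" "S \<in> set_pmf (bernoulli_set A p)"
  shows "S \<subseteq> A"
  using assms(2) subsetD[OF set_Pi_pmf_subset[OF assms(1)]] unfolding bernoulli_set_def by fastforce

text \<open>Serves to read the attachment coins, which are indexed by the old nodes, as coins
  indexed by the pairs through the new node.\<close>

lemma bernoulli_set_image:
  assumes "finite A" "inj_on h A"
  shows "bernoulli_set (h ` A) p = map_pmf ((`) h) (bernoulli_set A (\<lambda>x. p (h x)))"
  using assms
proof (induction A rule: finite_induct)
  case (insert x A)
  then have "h x \<notin> h ` A" by auto
  with insert show ?case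
    by (auto simp: bernoulli_set_insert map_bind_pmf map_pmf_comp intro!: bind_pmf_cong map_pmf_cong)
qed simp

lemma bernoulli_set_union:
  assumes "finite A" "finite B" "A \<inter> B = {}"
  shows "bernoulli_set (A \<union> B) p =
    bind_pmf (bernoulli_set A p) (\<lambda>S. map_pmf (\<lambda>T. S \<union> T) (bernoulli_set B p))"
  using assms(1,3)
proof (induction A rule: finite_induct)
  case (insert x A)
  with assms(2) have "x \<notin> A \<union> B" "finite (A \<union> B)" "A \<inter> B = {}" by auto
  with insert show ?case
    by (auto simp: bernoulli_set_insert map_bind_pmf bind_map_pmf bind_assoc_pmf map_pmf_comp
        intro!: bind_pmf_cong map_pmf_cong)
qed (simp add: bind_return_pmf map_pmf_idI)

text \<open>The single-element case of \<open>bernoulli_set_superposition\<close>: the second coin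
  is tossed only after the first has failed, so the outcome is negative exactly when both
  fail.\<close>

lemma bernoulli_pmf_disj:
  assumes "p \<in> {0..1}" "r \<in> {0..1}"
  shows "bind_pmf (bernoulli_pmf p) (\<lambda>b. if b then return_pmf True else bernoulli_pmf r) =
    bernoulli_pmf (1 - (1 - p) * (1 - r))"
proof -
  have "0 \<le> (1 - p) * (1 - r)" "(1 - p) * (1 - r) \<le> 1"
    using assms by (auto intro!: mult_le_one)
  then show ?thesis
    using assms
    by (intro pmf_eqI, case_tac i) (simp_all add: pmf_bind algebra_simps)
qed

text \<open>
  In a step of the process the coins of the second stage are tossed only for the pairs left over
  by the first stage; the result is still a product law.
\<close>

lemma bernoulli_set_superposition:
  assumes "finite A" "\<And>x. x \<in> A \<Longrightarrow> p x \<in> {0..1}" "\<And>x. x \<in> A \<Longrightarrow> r x \<in> {0..1}"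
  shows "bind_pmf (bernoulli_set A p) (\<lambda>S. map_pmf (\<lambda>T. S \<union> T) (bernoulli_set (A - S) r)) =
    bernoulli_set A (\<lambda>x. 1 - (1 - p x) * (1 - r x))"
  using assms
proof (induction A rule: finite_induct)
  case (insert x A)
  let ?I = "\<lambda>b S. if b then insert x S else S"
  let ?next = "\<lambda>b. if b then return_pmf True else bernoulli_pmf (r x)"
  \<comment> \<open>The fate of \<open>x\<close> is separated from that of \<open>A\<close>: after a
    success \<open>x\<close> has left the set of the second round, after a failure it is still there
    and receives its own coin.\<close>
  have step: "map_pmf (\<lambda>T. ?I b S \<union> T) (bernoulli_set (insert x A - ?I b S) r) =
      bind_pmf (?next b) (\<lambda>b'. map_pmf (\<lambda>T. ?I b' (S \<union> T)) (bernoulli_set (A - S) r))"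
    if "S \<in> set_pmf (bernoulli_set A p)" for b S
  proof -
    have "x \<notin> S" using bernoulli_set_subset[OF insert(1) that] insert(2) by auto
    then have "insert x A - insert x S = A - S" "insert x A - S = insert x (A - S)"
      using insert(2) by auto
    moreover have "S \<union> (if c then insert x T else T) = (if c then insert x (S \<union> T) else S \<union> T)" for c T
      by auto
    ultimately show ?thesis using insert(1,2)
      by (cases b) (simp_all add: bernoulli_set_insert bind_return_pmf map_bind_pmf map_pmf_comp)
  qed
  have "bind_pmf (bernoulli_set (insert x A) p)
        (\<lambda>S. map_pmf (\<lambda>T. S \<union> T) (bernoulli_set (insert x A - S) r)) =
      bind_pmf (bernoulli_pmf (p x)) (\<lambda>b. bind_pmf (bernoulli_set A p)
        (\<lambda>S. map_pmf (\<lambda>T. ?I b S \<union> T) (bernoulli_set (insert x A - ?I b S) r)))"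
    using insert(1,2) by (simp add: bernoulli_set_insert bind_assoc_pmf bind_map_pmf)
  also have "\<dots> = bind_pmf (bernoulli_pmf (p x)) (\<lambda>b. bind_pmf (bernoulli_set A p)
      (\<lambda>S. bind_pmf (?next b) (\<lambda>b'. map_pmf (\<lambda>T. ?I b' (S \<union> T)) (bernoulli_set (A - S) r))))"
    by (intro bind_pmf_cong refl step)
  \<comment> \<open>The second coin of \<open>x\<close> depends on \<open>b\<close> but not on
    \<open>S\<close>, so it can be tossed before \<open>S\<close> is drawn and merged with the first
    coin.\<close>
  also have "\<dots> = bind_pmf (bind_pmf (bernoulli_pmf (p x)) ?next) (\<lambda>b'. map_pmf (?I b')
      (bind_pmf (bernoulli_set A p) (\<lambda>S. map_pmf (\<lambda>T. S \<union> T) (bernoulli_set (A - S) r))))"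
    unfolding bind_assoc_pmf map_bind_pmf map_pmf_comp
    by (intro bind_pmf_cong refl) (rule bind_commute_pmf)
  also have "\<dots> = bernoulli_set (insert x A) (\<lambda>x. 1 - (1 - p x) * (1 - r x))"
    using insert by (simp add: bernoulli_set_insert bernoulli_pmf_disj)
  finally show ?case .
qed (simp add: bind_return_pmf)

text \<open>The factor 0 off \<open>A\<close> anticipates the application: \<open>S\<close> will be
  the image of the edges of a graph under a map that may collapse an edge to a singleton, and then
  the event is impossible.\<close>

lemma prob_bernoulli_set_superset:
  assumes "finite A" "finite S" "\<And>x. x \<in> A \<Longrightarrow> p x \<in> {0..1}"
  shows "measure_pmf.prob (bernoulli_set A p) {E. S \<subseteq> E} = (\<Prod>s\<in>S. if s \<in> A then p s else 0)"
proof (cases "S \<subseteq> A")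
  case True
  have "measure_pmf.prob (bernoulli_set A p) {E. S \<subseteq> E} =
      measure_pmf.prob (Pi_pmf A False (\<lambda>x. bernoulli_pmf (p x))) (Pi A (\<lambda>s. {b. s \<in> S \<longrightarrow> b}))"
    using True unfolding bernoulli_set_def measure_map_pmf
    by (intro arg_cong[where f = "measure_pmf.prob _"]) auto
  also have "\<dots> = (\<Prod>s\<in>A. if s \<in> S then p s else 1)"
    unfolding measure_Pi_pmf_Pi[OF assms(1)]
  proof (intro prod.cong refl)
    fix s assume "s \<in> A"
    have "{b. b} = {True}" by auto
    then show "measure_pmf.prob (bernoulli_pmf (p s)) {b. s \<in> S \<longrightarrow> b} = (if s \<in> S then p s else 1)"
      using assms(3)[OF \<open>s \<in> A\<close>] by (auto simp: measure_pmf_single)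
  qed
  also have "\<dots> = (\<Prod>s\<in>S. p s)"
    using True assms(1) by (simp add: prod.If_cases Int_absorb1)
  also have "\<dots> = (\<Prod>s\<in>S. if s \<in> A then p s else 0)"
    using True by (intro prod.cong) auto
  finally show ?thesis .
next
  case False
  then obtain s where s: "s \<in> S" "s \<notin> A" by auto
  have "measure_pmf.prob (bernoulli_set A p) {E. S \<subseteq> E} = 0"
    using bernoulli_set_subset[OF assms(1)] s by (subst measure_pmf_zero_iff) fastforce
  then show ?thesis using s assms(2) by (auto intro!: prod_zero)
qed

subsection \<open>The law of the graph after n iterations\<close>

text \<open>
  The probability that the pair \<open>e\<close> is nonadjacent after iteration \<open>n\<close>: it has to be missed by the
  attachment of its later node and by every later round of random edges.
\<close>

definition nonadj :: "nat \<Rightarrow> nat set \<Rightarrow> real" where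
  "nonadj n e = real (Min e) / real (Max e) * (\<Prod>k = Max e..n. 1 - min 1 (2 / real k))"

lemma vertex_pairs_eq: "vertex_pairs V = {{i, j} | i j. i \<in> V \<and> j \<in> V \<and> i \<noteq> j}"
  unfolding vertex_pairs_def by (auto simp: card_2_iff)

lemma finite_vertex_pairs [simp]: "finite V \<Longrightarrow> finite (vertex_pairs V)"
  unfolding vertex_pairs_def by (auto intro: finite_subset[of _ "Pow V"])

lemma vertex_pairs_atMost_Suc:
  "vertex_pairs {..Suc n} = vertex_pairs {..n} \<union> (\<lambda>i. {i, Suc n}) ` {..n}"
proof -
  have "{i, j} \<in> vertex_pairs {..n} \<union> (\<lambda>i. {i, Suc n}) ` {..n}"
    if "i \<le> Suc n" "j \<le> Suc n" "i \<noteq> j" for i j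
    using that by (cases "i = Suc n"; cases "j = Suc n") (auto simp: vertex_pairs_eq)
  then show ?thesis by (auto simp: vertex_pairs_eq) fastforce+
qed

lemma nonadj_bounds: "nonadj n e \<in> {0..1}" if "e \<in> vertex_pairs V" for V
proof -
  have e: "finite e" "e \<noteq> {}"
    using that by (auto simp: vertex_pairs_eq)
  then have "real (Min e) / real (Max e) \<le> 1" by (simp add: divide_le_eq)
  moreover have "(\<Prod>k = Max e..n. 1 - min 1 (2 / real k)) \<in> {0..1}"
    by (auto intro!: prod_nonneg prod_le_1)
  ultimately show ?thesis
    unfolding nonadj_def by (auto simp del: times_divide_eq_left intro!: mult_le_one)
qed

lemma nonadj_Suc_old:
  assumes "e \<in> vertex_pairs {..n}"
  shows "nonadj (Suc n) e = nonadj n e * (1 - min 1 (2 / real (Suc n)))"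
proof -
  have "finite e" "e \<noteq> {}" "e \<subseteq> {..n}"
    using assms by (auto simp: vertex_pairs_eq)
  then have "Max e \<le> n" by auto
  then show ?thesis by (simp add: nonadj_def)
qed

lemma nonadj_Suc_new:
  assumes "i \<le> n"
  shows "nonadj (Suc n) {i, Suc n} = real i / real (Suc n) * (1 - min 1 (2 / real (Suc n)))"
  using assms by (simp add: nonadj_def max_def min_def)

definition ra_graph :: "nat \<Rightarrow> nat set set \<Rightarrow> nat graph" where
  "ra_graph n E = \<lparr>verts = {..n}, edges = E\<rparr>"

lemma ra_graph_simps [simp]: "verts (ra_graph n E) = {..n}" "edges (ra_graph n E) = E"
  by (simp_all add: ra_graph_def)

text \<open>The candidate for the law at time \<open>n\<close> in closed form;
  \<open>ra_law_0\<close> and \<open>ra_law_Suc\<close> show that it obeys the recursion of the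
  process.\<close>

definition ra_law :: "nat \<Rightarrow> nat graph pmf" where
  "ra_law n = map_pmf (ra_graph n) (bernoulli_set (vertex_pairs {..n}) (\<lambda>e. 1 - nonadj n e))"

lemma ra_law_0: "ra_law 0 = return_pmf \<lparr>verts = {0}, edges = {}\<rparr>"
proof -
  have "vertex_pairs {..0::nat} = {}" by (auto simp: vertex_pairs_eq)
  then show ?thesis by (simp add: ra_law_def ra_graph_def)
qed

lemma ra_step_ra_graph:
  "ra_step (Suc n) (ra_graph n E) =
    bind_pmf (bernoulli_set {..n} (\<lambda>i. 1 - real i / real (Suc n))) (\<lambda>A.
      let E' = E \<union> (\<lambda>i. {i, Suc n}) ` A in
      map_pmf (\<lambda>T. ra_graph (Suc n) (E' \<union> T))
        (bernoulli_set (vertex_pairs {..Suc n} - E') (\<lambda>_. min 1 (2 / real (Suc n)))))"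
proof -
  let ?P = "Pi_pmf {..n} False (\<lambda>i. bernoulli_pmf (1 - real i / real (Suc n)))"
  \<comment> \<open>The default value \<open>False\<close> confines \<open>Collect a\<close> to
    \<open>{..n}\<close>.\<close>
  have *: "{{i, Suc n} |i. i \<in> {..n} \<and> a i} = (\<lambda>i. {i, Suc n}) ` Collect a"
    if "a \<in> set_pmf ?P" for a
    using subsetD[OF set_Pi_pmf_subset that] by auto
  have "insert (Suc n) {..n} = {..Suc n}" by auto
  then show ?thesis
    unfolding ra_step_def bernoulli_set_def bind_map_pmf ra_graph_simps
    by (intro bind_pmf_cong refl) (simp only: * Let_def map_pmf_comp ra_graph_def)
qed

lemma ra_law_Suc: "ra_law (Suc n) = bind_pmf (ra_law n) (ra_step (Suc n))"
proof -
  let ?P = "vertex_pairs {..n}" and ?Q = "(\<lambda>i. {i, Suc n}) ` {..n}"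
  let ?r = "min 1 (2 / real (Suc n))"
  \<comment> \<open>The probability that a pair is present after the new node has been attached and
    before the second round: inherited for an old pair, the attachment probability for a pair
    through \<open>Suc n\<close>. With a single function for both blocks, they join into one product
    law, to which superposition with \<open>?r\<close> applies.\<close>
  let ?p = "\<lambda>e. if e \<in> ?P then 1 - nonadj n e else 1 - real (Min e) / real (Suc n)"
  let ?f = "\<lambda>E. map_pmf (\<lambda>T. E \<union> T) (bernoulli_set (?P \<union> ?Q - E) (\<lambda>_. ?r))"
  have disj: "?P \<inter> ?Q = {}" by (auto simp: vertex_pairs_def)
  have inj: "inj_on (\<lambda>i. {i, Suc n}) {..n}"
    by (auto simp: inj_on_def doubleton_eq_iff)
  have Q: "?p {i, Suc n} = 1 - real i / real (Suc n)" if "i \<le> n" for i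
    using that disj by (auto simp: min_def)
  have bounds: "?p e \<in> {0..1}" if "e \<in> ?P \<union> ?Q" for e
    using that nonadj_bounds[of e "{..n}" n] Q by (cases "e \<in> ?P") auto
  have "bind_pmf (ra_law n) (ra_step (Suc n)) = map_pmf (ra_graph (Suc n))
      (bind_pmf (bernoulli_set ?P (\<lambda>e. 1 - nonadj n e)) (\<lambda>E.
        bind_pmf (map_pmf ((`) (\<lambda>i. {i, Suc n})) (bernoulli_set {..n} (\<lambda>i. 1 - real i / real (Suc n))))
          (\<lambda>D. ?f (E \<union> D))))"
    by (simp add: ra_law_def bind_map_pmf ra_step_ra_graph Let_def map_bind_pmf map_pmf_comp
        vertex_pairs_atMost_Suc)
  also have "map_pmf ((`) (\<lambda>i. {i, Suc n})) (bernoulli_set {..n} (\<lambda>i. 1 - real i / real (Suc n))) =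
      bernoulli_set ?Q ?p"
    unfolding bernoulli_set_image[OF finite_atMost inj]
    by (intro map_pmf_cong bernoulli_set_cong refl) (use Q in auto)
  also have "bernoulli_set ?P (\<lambda>e. 1 - nonadj n e) = bernoulli_set ?P ?p"
    by (intro bernoulli_set_cong) auto
  also have "bind_pmf (bernoulli_set ?P ?p) (\<lambda>E. bind_pmf (bernoulli_set ?Q ?p) (\<lambda>D. ?f (E \<union> D))) =
      bind_pmf (bernoulli_set (?P \<union> ?Q) ?p) ?f"
    by (simp add: bernoulli_set_union[OF _ _ disj] bind_assoc_pmf bind_map_pmf)
  also have "\<dots> = bernoulli_set (?P \<union> ?Q) (\<lambda>e. 1 - (1 - ?p e) * (1 - ?r))"
    by (intro bernoulli_set_superposition bounds) auto
  also have "\<dots> = bernoulli_set (vertex_pairs {..Suc n}) (\<lambda>e. 1 - nonadj (Suc n) e)"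
  proof (rule bernoulli_set_cong)
    fix e assume "e \<in> vertex_pairs {..Suc n}"
    then consider "e \<in> ?P" | i where "i \<le> n" "e = {i, Suc n}"
      unfolding vertex_pairs_atMost_Suc by auto
    then show "1 - (1 - ?p e) * (1 - ?r) = 1 - nonadj (Suc n) e"
    proof cases
      case 1
      then show ?thesis by (simp add: nonadj_Suc_old)
    next
      case 2
      then have "e \<notin> ?P" by (auto simp: vertex_pairs_def)
      then show ?thesis using 2 Q[of i] nonadj_Suc_new[of i n] by simp
    qed
  qed (simp add: vertex_pairs_atMost_Suc)
  finally show ?thesis by (simp add: ra_law_def)
qed

section \<open>From path probabilities to the law of a single graph\<close>

text \<open>The values may range over an uncountable type, so point masses alone settle only
  countable sets. The support of \<open>P\<close> is countable and has full mass; hence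
  \<open>X\<close> lies in it almost surely, and an arbitrary \<open>D\<close> can be cut down to
  it.\<close>

lemma (in prob_space) emeasure_eq_of_point_masses:
  assumes points: "\<And>y. {\<omega> \<in> space M. X \<omega> = y} \<in> events"
    "\<And>y. prob {\<omega> \<in> space M. X \<omega> = y} = pmf P y"
  assumes D: "{\<omega> \<in> space M. X \<omega> \<in> D} \<in> events"
  shows "emeasure M {\<omega> \<in> space M. X \<omega> \<in> D} = emeasure (measure_pmf P) D"
proof -
  have countable: "emeasure M {\<omega> \<in> space M. X \<omega> \<in> C} = emeasure (measure_pmf P) C"
    if "countable C" for C
  proof -
    have "emeasure M {\<omega> \<in> space M. X \<omega> \<in> C} = emeasure M (\<Union>y\<in>C. {\<omega> \<in> space M. X \<omega> = y})"
      by (rule arg_cong[where f = "emeasure M"]) auto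
    also have "\<dots> = (\<integral>\<^sup>+ y. emeasure M {\<omega> \<in> space M. X \<omega> = y} \<partial>count_space C)"
      using that points by (intro emeasure_UN_countable) (auto simp: disjoint_family_on_def)
    also have "\<dots> = (\<integral>\<^sup>+ y. pmf P y \<partial>count_space C)"
      by (simp add: emeasure_eq_measure points(2))
    also have "\<dots> = emeasure (measure_pmf P) C"
      by (simp add: nn_integral_pmf)
    finally show ?thesis .
  qed
  let ?S = "set_pmf P"
  have ev: "{\<omega> \<in> space M. X \<omega> \<in> ?S} \<in> events"
  proof -
    have "{\<omega> \<in> space M. X \<omega> \<in> ?S} = (\<Union>y\<in>?S. {\<omega> \<in> space M. X \<omega> = y})" by auto
    also have "\<dots> \<in> events" using points(1) by (intro sets.countable_UN') auto
    finally show ?thesis .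
  qed
  have "emeasure (measure_pmf P) ?S = 1"
    by (intro measure_pmf.emeasure_eq_1_AE) (auto simp: AE_measure_pmf)
  then have "emeasure M {\<omega> \<in> space M. X \<omega> \<in> ?S} = 1"
    by (simp add: countable)
  then have "AE \<omega> in M. X \<omega> \<in> ?S"
    using ev by (subst AE_iff_emeasure_eq_1) auto
  moreover have "{\<omega> \<in> space M. X \<omega> \<in> D \<inter> ?S} = {\<omega> \<in> space M. X \<omega> \<in> D} \<inter> {\<omega> \<in> space M. X \<omega> \<in> ?S}"
    by auto
  ultimately have "emeasure M {\<omega> \<in> space M. X \<omega> \<in> D} = emeasure M {\<omega> \<in> space M. X \<omega> \<in> D \<inter> ?S}"
    using D ev by (intro emeasure_eq_AE) auto
  also have "\<dots> = emeasure (measure_pmf P) (D \<inter> ?S)"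
    by (rule countable) auto
  also have "\<dots> = emeasure (measure_pmf P) D"
    by (intro emeasure_eq_AE) (auto simp: AE_measure_pmf_iff)
  finally show ?thesis .
qed

text \<open>The newest entry comes first, so that a step of the chain is a \<open>Cons\<close> and
  the current state is the \<open>hd\<close>.\<close>

primrec history :: "(nat \<Rightarrow> 'g) \<Rightarrow> nat \<Rightarrow> 'g list" where
  "history g 0 = [g 0]"
| "history g (Suc n) = g (Suc n) # history g n"

lemma history_eq_iff: "history g n = history h n \<longleftrightarrow> (\<forall>k\<le>n. g k = h k)"
  by (induction n) (auto simp: le_Suc_eq)

lemma hd_history [simp]: "hd (history g n) = g n"
  by (cases n) auto

lemma history_surj: "length p = Suc n \<Longrightarrow> \<exists>g. p = history g n"
proof (induction n arbitrary: p)
  case 0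
  then show ?case by (auto simp: length_Suc_conv)
next
  case (Suc n)
  then obtain x p' where p: "p = x # p'" "length p' = Suc n" by (auto simp: length_Suc_conv)
  with Suc obtain g where g: "p' = history g n" by blast
  then have "p' = history (g(Suc n := x)) n" by (simp add: history_eq_iff)
  then have "p = history (g(Suc n := x)) (Suc n)"
    using p by (simp only: history.simps fun_upd_same)
  then show ?case by blast
qed

lemma length_history [simp]: "length (history g n) = Suc n"
  by (induction n) auto

text \<open>The law of whole paths, since \<open>iteration\<close> speaks of joint probabilities;
  the marginal at the last time is taken afterwards in \<open>map_hd_history_pmf\<close>.\<close>

primrec history_pmf :: "nat \<Rightarrow> nat graph list pmf" where
  "history_pmf 0 = return_pmf [\<lparr>verts = {0}, edges = {}\<rparr>]"
| "history_pmf (Suc n) =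
    bind_pmf (history_pmf n) (\<lambda>p. map_pmf (\<lambda>h. h # p) (ra_step (Suc n) (hd p)))"

lemma length_history_pmf: "p \<in> set_pmf (history_pmf n) \<Longrightarrow> length p = Suc n"
  by (induction n arbitrary: p) auto

text \<open>A list determines its tail, so of all the pasts that are averaged over only
  \<open>p\<close> contributes. The result has the same shape as the assumption
  \<open>iteration\<close>.\<close>

lemma pmf_history_pmf_Suc:
  "pmf (history_pmf (Suc n)) (h # p) = pmf (history_pmf n) p * pmf (ra_step (Suc n) (hd p)) h"
proof -
  have "pmf (map_pmf (\<lambda>h. h # p') (ra_step (Suc n) (hd p'))) (h # p) =
      indicator {p} p' * pmf (ra_step (Suc n) (hd p)) h" for p'
  proof (cases "p' = p")
    case True
    have "inj (\<lambda>h. h # p)" by (auto simp: inj_def)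
    then show ?thesis using True pmf_map_inj'[of "\<lambda>h. h # p"] by simp
  next
    case False
    then show ?thesis by (auto simp: pmf_eq_0_set_pmf)
  qed
  then show ?thesis by (simp add: pmf_bind measure_pmf_single)
qed

lemma map_hd_history_pmf: "map_pmf hd (history_pmf n) = ra_law n"
proof (induction n)
  case (Suc n)
  have "map_pmf hd (history_pmf (Suc n)) = bind_pmf (map_pmf hd (history_pmf n)) (ra_step (Suc n))"
    by (simp add: map_bind_pmf bind_map_pmf map_pmf_comp)
  then show ?case using Suc by (simp add: ra_law_Suc)
qed (simp add: ra_law_0)

context ra_graph_sequence
begin

lemma graph_event: "{\<omega> \<in> space M. G n \<omega> \<in> D} \<in> events"
  using measurable_sets[OF random_graph[of n], of D] by (simp add: vimage_def Int_def conj_commute)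

lemma history_event: "{\<omega> \<in> space M. history (\<lambda>k. G k \<omega>) n = p} \<in> events"
proof (cases "length p = Suc n")
  case True
  then obtain g where "p = history g n" using history_surj by blast
  then have "{\<omega> \<in> space M. history (\<lambda>k. G k \<omega>) n = p} = {\<omega> \<in> space M. \<forall>k\<in>{..n}. G k \<omega> \<in> {g k}}"
    by (auto simp: history_eq_iff)
  also have "\<dots> \<in> events"
    by (intro sets.sets_Collect_finite_All graph_event) simp
  finally show ?thesis .
next
  case False
  then have "{\<omega> \<in> space M. history (\<lambda>k. G k \<omega>) n = p} = {}" by auto
  then show ?thesis by (simp only: sets.empty_sets)
qed

lemma prob_history: "prob {\<omega> \<in> space M. history (\<lambda>k. G k \<omega>) n = p} = pmf (history_pmf n) p"
proof (cases "length p = Suc n")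
  case True
  then obtain g where "p = history g n" using history_surj by blast
  moreover have "prob {\<omega> \<in> space M. \<forall>k\<le>n. G k \<omega> = g k} = pmf (history_pmf n) (history g n)"
  proof (induction n)
    case 0
    have "prob {\<omega> \<in> space M. G 0 \<omega> = g 0} =
        prob (if g 0 = \<lparr>verts = {0}, edges = {}\<rparr> then space M else {})"
      using start graph_event[of 0 "{g 0}"] by (intro finite_measure_eq_AE) auto
    then show ?case by (auto simp: prob_space)
  next
    case (Suc n)
    then show ?case
      unfolding iteration history.simps(2) pmf_history_pmf_Suc by simp
  qed
  ultimately show ?thesis by (simp add: history_eq_iff)
next
  case False
  then have "{\<omega> \<in> space M. history (\<lambda>k. G k \<omega>) n = p} = {}" by auto
  then show ?thesis
    using False length_history_pmf by (metis measure_empty pmf_eq_0_set_pmf)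
qed

text \<open>With this, expectations over \<open>M\<close> of a function of \<open>G n\<close> become
  expectations over independent pairs, the only form in which the chain is used from here
  on.\<close>

lemma distr_graph: "distr M (count_space UNIV) (G n) = measure_pmf (ra_law n)"
proof (rule measure_eqI)
  fix D :: "nat graph set"
  have "emeasure (distr M (count_space UNIV) (G n)) D = emeasure M {\<omega> \<in> space M. G n \<omega> \<in> D}"
    using random_graph[of n]
    by (subst emeasure_distr) (auto intro!: arg_cong[where f = "emeasure M"])
  also have "\<dots> = emeasure M {\<omega> \<in> space M. history (\<lambda>k. G k \<omega>) n \<in> {p. hd p \<in> D}}"
    by simp
  also have "\<dots> = emeasure (measure_pmf (history_pmf n)) {p. hd p \<in> D}"
    using graph_event by (intro emeasure_eq_of_point_masses history_event prob_history) simp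
  also have "\<dots> = emeasure (measure_pmf (ra_law n)) D"
    unfolding map_hd_history_pmf[symmetric] emeasure_map_pmf by (simp add: vimage_def)
  finally show "emeasure (distr M (count_space UNIV) (G n)) D = emeasure (measure_pmf (ra_law n)) D" .
qed simp

end

subsection \<open>Variance and edge probabilities\<close>

text \<open>Expanding the square gives a sum of covariances of the events that \<open>S i\<close> or
  \<open>S j\<close> is contained in the random set. Pairs without a common element in
  \<open>A\<close> contribute nothing, and every other covariance is at most 1.\<close>

lemma bernoulli_set_variance:
  assumes A: "finite A" "\<And>x. x \<in> A \<Longrightarrow> p x \<in> {0..1}"
    and I: "finite I" "\<And>i. i \<in> I \<Longrightarrow> finite (S i)"
  defines "\<mu> \<equiv> \<lambda>i. \<Prod>s\<in>S i. if s \<in> A then p s else 0"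
  shows "measure_pmf.expectation (bernoulli_set A p) (\<lambda>E. (\<Sum>i\<in>I. of_bool (S i \<subseteq> E) - \<mu> i)\<^sup>2)
    \<le> real (card {(i, j) \<in> I \<times> I. S i \<inter> S j \<inter> A \<noteq> {}})"
proof -
  let ?P = "bernoulli_set A p"
  let ?p = "\<lambda>s. if s \<in> A then p s else 0"
  let ?C = "{(i, j) \<in> I \<times> I. S i \<inter> S j \<inter> A \<noteq> {}}"
  have "set_pmf ?P \<subseteq> Pow A" using bernoulli_set_subset[OF A(1)] by auto
  then have fin: "finite (set_pmf ?P)" using A(1) finite_subset by blast
  note integrable [simp] = integrable_measure_pmf_finite[OF fin]
  have p: "?p s \<in> {0..1}" for s using A(2) by auto
  have exp: "measure_pmf.expectation ?P (\<lambda>E. of_bool (T \<subseteq> E)) = (\<Prod>s\<in>T. ?p s)"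
    if "finite T" for T
  proof -
    have "(\<lambda>E. of_bool (T \<subseteq> E)) = indicat_real {E. T \<subseteq> E}" by (auto simp: indicator_def)
    then show ?thesis using prob_bernoulli_set_superset[OF A(1) that A(2)] by simp
  qed
  have cov: "measure_pmf.expectation ?P (\<lambda>E. (of_bool (S i \<subseteq> E) - \<mu> i) * (of_bool (S j \<subseteq> E) - \<mu> j)) =
      (\<Prod>s\<in>S i \<union> S j. ?p s) - \<mu> i * \<mu> j" if "i \<in> I" "j \<in> I" for i j
  proof -
    have "measure_pmf.expectation ?P (\<lambda>E. (of_bool (S i \<subseteq> E) - \<mu> i) * (of_bool (S j \<subseteq> E) - \<mu> j)) =
        measure_pmf.expectation ?P (\<lambda>E. of_bool (S i \<union> S j \<subseteq> E) - \<mu> j * of_bool (S i \<subseteq> E)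
          - \<mu> i * of_bool (S j \<subseteq> E) + \<mu> i * \<mu> j)"
      by (intro Bochner_Integration.integral_cong) (auto simp: algebra_simps of_bool_conj)
    also have "\<dots> = (\<Prod>s\<in>S i \<union> S j. ?p s) - \<mu> j * \<mu> i - \<mu> i * \<mu> j + \<mu> i * \<mu> j"
      using I(2) that exp[of "S i \<union> S j"] exp[of "S i"] exp[of "S j"] by (simp del: Un_subset_iff add: \<mu>_def)
    finally show ?thesis by simp
  qed
  have le: "(\<Prod>s\<in>S i \<union> S j. ?p s) - \<mu> i * \<mu> j \<le> of_bool ((i, j) \<in> ?C)" if "i \<in> I" "j \<in> I" for i j
  proof -
    have bound: "0 \<le> (\<Prod>s\<in>T. ?p s)" "(\<Prod>s\<in>T. ?p s) \<le> 1" for T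
      using p by (intro prod_nonneg prod_le_1; simp only: atLeastAtMost_iff)+
    have fin: "finite (S i)" "finite (S j)" using I(2) that by auto
    have "(i, j) \<in> ?C \<longleftrightarrow> S i \<inter> S j \<inter> A \<noteq> {}" using that by simp
    \<comment> \<open>Disjoint sets give independent events. A common element outside
      \<open>A\<close> makes both events impossible, so the covariance vanishes there as
      well.\<close>
    then consider "S i \<inter> S j = {}" | s where "s \<in> S i \<inter> S j" "s \<notin> A" | "(i, j) \<in> ?C"
      by (cases "S i \<inter> S j \<inter> A = {}") fast+
    then show ?thesis
    proof cases
      case 1
      then show ?thesis using fin by (simp add: \<mu>_def prod.union_disjoint)
    next
      case 2
      then have "(\<Prod>s\<in>S i \<union> S j. ?p s) = 0" using fin by (intro prod_zero) auto
      moreover have "\<mu> i = 0" unfolding \<mu>_def using 2 fin by (intro prod_zero) auto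
      ultimately show ?thesis by simp
    next
      case 3
      moreover have "0 \<le> \<mu> i * \<mu> j" unfolding \<mu>_def by (intro mult_nonneg_nonneg bound)
      ultimately show ?thesis using bound(2)[of "S i \<union> S j"] by (simp only: of_bool_eq)
    qed
  qed
  have "measure_pmf.expectation ?P (\<lambda>E. (\<Sum>i\<in>I. of_bool (S i \<subseteq> E) - \<mu> i)\<^sup>2) =
      (\<Sum>i\<in>I. \<Sum>j\<in>I. (\<Prod>s\<in>S i \<union> S j. ?p s) - \<mu> i * \<mu> j)"
    by (simp add: power2_eq_square sum_product Bochner_Integration.integral_sum cov)
  also have "\<dots> \<le> (\<Sum>i\<in>I. \<Sum>j\<in>I. of_bool ((i, j) \<in> ?C))"
    by (intro sum_mono le)
  also have "\<dots> = (\<Sum>x\<in>I \<times> I. of_bool (x \<in> ?C))"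
    by (simp only: sum.cartesian_product case_prod_unfold prod.collapse)
  also have "\<dots> = real (card ?C)"
  proof -
    have "I \<times> I \<inter> {x. x \<in> ?C} = ?C" by auto
    then show ?thesis using I(1) by (simp add: of_bool_def sum.If_cases)
  qed
  finally show ?thesis .
qed

section \<open>Counting maps that overlap or fail to be injective\<close>

text \<open>The multiplied form keeps natural number subtraction out of the exponent. The values
  \<open>a\<close> and \<open>b\<close> may coincide, which is how collisions are counted in
  \<open>card_non_injective\<close>.\<close>

lemma card_PiE_prescribe_two:
  assumes "finite U" "i \<in> U" "j \<in> U" "i \<noteq> j" "a \<in> V" "b \<in> V"
  shows "card {\<psi> \<in> U \<rightarrow>\<^sub>E V. \<psi> i = a \<and> \<psi> j = b} * card V ^ 2 = card V ^ card U"
proof -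
  let ?B = "\<lambda>u. if u = i then {a} else if u = j then {b} else V"
  have U: "U = insert i (insert j (U - {i, j}))" using assms by auto
  have card: "card U = card (U - {i, j}) + 2"
    using assms by (subst U, subst card_insert_disjoint) auto
  have "{\<psi> \<in> U \<rightarrow>\<^sub>E V. \<psi> i = a \<and> \<psi> j = b} = PiE U ?B"
    using assms by (auto simp: PiE_iff extensional_def split: if_splits)
  then have "card {\<psi> \<in> U \<rightarrow>\<^sub>E V. \<psi> i = a \<and> \<psi> j = b} = (\<Prod>u\<in>U. card (?B u))"
    using assms(1) by (simp add: card_PiE)
  also have "\<dots> = (\<Prod>u\<in>U - {i, j}. card (?B u))"
    using assms by (intro prod.mono_neutral_right) auto
  also have "\<dots> = card V ^ card (U - {i, j})"
    by (simp)
  finally show ?thesis by (simp add: card power_add power2_eq_square)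
qed

text \<open>If the edges \<open>e\<close> and \<open>f = {k, l}\<close> have the same image under
  \<open>\<phi>\<close> and \<open>\<psi>\<close>, then \<open>\<psi> k\<close> and
  \<open>\<psi> l\<close> are values of \<open>\<phi>\<close> at nodes \<open>i\<close> and
  \<open>j\<close>. For fixed \<open>\<phi>\<close> there are at most
  \<open>card (verts F) ^ 4\<close> such quadruples, and each prescribes two values of
  \<open>\<psi>\<close>.\<close>

lemma card_overlapping_pairs:
  assumes F: "finite_simple_graph F" and V: "finite V" "V \<noteq> {}"
  shows "real (card {(\<phi>, \<psi>) \<in> (verts F \<rightarrow>\<^sub>E V) \<times> (verts F \<rightarrow>\<^sub>E V).
      (`) \<phi> ` edges F \<inter> (`) \<psi> ` edges F \<inter> A \<noteq> {}})
    \<le> real (card (verts F)) ^ 4 * (real (card V) ^ card (verts F)) ^ 2 / real (card V) ^ 2"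
proof -
  let ?U = "verts F" and ?\<Phi> = "verts F \<rightarrow>\<^sub>E V"
  \<comment> \<open>Only \<open>k\<close> and \<open>l\<close> must differ, so that two values are
    really prescribed; \<open>i = j\<close> has to be allowed because the maps may collapse
    edges.\<close>
  let ?Q = "{(i, j, k, l). i \<in> ?U \<and> j \<in> ?U \<and> k \<in> ?U \<and> l \<in> ?U \<and> k \<noteq> l}"
  let ?R = "\<lambda>(i, j, k, l) \<phi>. {\<psi> \<in> ?\<Phi>. \<psi> k = \<phi> i \<and> \<psi> l = \<phi> j}"
  let ?c = "real (card V) ^ card ?U / real (card V) ^ 2"
  have U: "finite ?U" using F by (auto simp: finite_simple_graph_def)
  have fin: "finite ?\<Phi>" using U V by (auto intro: finite_PiE)
  have Q: "?Q \<subseteq> ?U \<times> ?U \<times> ?U \<times> ?U" by auto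
  then have finQ: "finite ?Q" using U finite_subset by blast
  have cardQ: "card ?Q \<le> card ?U ^ 4"
    using card_mono[OF _ Q] U by (simp add: card_cartesian_product numeral_eq_Suc)
  have cover: "{(\<phi>, \<psi>) \<in> ?\<Phi> \<times> ?\<Phi>. (`) \<phi> ` edges F \<inter> (`) \<psi> ` edges F \<inter> A \<noteq> {}} \<subseteq>
      (SIGMA \<phi>:?\<Phi>. \<Union>q\<in>?Q. ?R q \<phi>)"
  proof safe
    fix \<phi> \<psi> e f
    assume \<phi>: "\<phi> \<in> ?\<Phi>" and \<psi>: "\<psi> \<in> ?\<Phi>" and ef: "e \<in> edges F" "f \<in> edges F" "\<phi> ` e = \<psi> ` f"
    from ef(2) F obtain k l where f: "f = {k, l}" "k \<noteq> l" "k \<in> ?U" "l \<in> ?U"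
      unfolding finite_simple_graph_def vertex_pairs_eq by blast
    have "e \<subseteq> ?U" using ef(1) F by (auto simp: finite_simple_graph_def vertex_pairs_def)
    moreover have "\<psi> k \<in> \<phi> ` e" "\<psi> l \<in> \<phi> ` e" using ef(3) f(1) by auto
    ultimately obtain i j where "i \<in> ?U" "j \<in> ?U" "\<psi> k = \<phi> i" "\<psi> l = \<phi> j" by blast
    then have "(i, j, k, l) \<in> ?Q" "\<psi> \<in> ?R (i, j, k, l) \<phi>" using f \<psi> by auto
    then show "\<psi> \<in> (\<Union>q\<in>?Q. ?R q \<phi>)" by blast
  qed
  have "real (card {(\<phi>, \<psi>) \<in> ?\<Phi> \<times> ?\<Phi>. (`) \<phi> ` edges F \<inter> (`) \<psi> ` edges F \<inter> A \<noteq> {}}) \<le>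
      real (card (SIGMA \<phi>:?\<Phi>. \<Union>q\<in>?Q. ?R q \<phi>))"
    using fin by (intro of_nat_mono card_mono cover finite_SigmaI) (auto intro: finite_subset[of _ ?\<Phi>])
  also have "\<dots> = (\<Sum>\<phi>\<in>?\<Phi>. real (card (\<Union>q\<in>?Q. ?R q \<phi>)))"
    using fin by (subst card_SigmaI) (auto intro: finite_subset[of _ ?\<Phi>])
  also have "\<dots> \<le> (\<Sum>\<phi>\<in>?\<Phi>. \<Sum>q\<in>?Q. ?c)"
  proof (rule sum_mono)
    fix \<phi> assume \<phi>: "\<phi> \<in> ?\<Phi>"
    have "real (card (\<Union>q\<in>?Q. ?R q \<phi>)) \<le> (\<Sum>q\<in>?Q. real (card (?R q \<phi>)))"
      using card_UN_le[OF finQ, of "\<lambda>q. ?R q \<phi>"] by (simp flip: of_nat_sum)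
    also have "\<dots> \<le> (\<Sum>q\<in>?Q. ?c)"
    proof (rule sum_mono)
      fix q assume "q \<in> ?Q"
      then obtain i j k l where q: "q = (i, j, k, l)" "i \<in> ?U" "j \<in> ?U" "k \<in> ?U" "l \<in> ?U" "k \<noteq> l"
        by auto
      have "\<phi> i \<in> V" "\<phi> j \<in> V" using \<phi> q by auto
      then have "card (?R q \<phi>) * card V ^ 2 = card V ^ card ?U"
        using card_PiE_prescribe_two[OF U q(4-6), of "\<phi> i" V "\<phi> j"] q(1) by simp
      then have "real (card (?R q \<phi>)) * real (card V) ^ 2 = real (card V) ^ card ?U"
        by (simp flip: of_nat_power of_nat_mult)
      then show "real (card (?R q \<phi>)) \<le> ?c"
        using V by (simp add: field_simps card_gt_0_iff)
    qed
    finally show "real (card (\<Union>q\<in>?Q. ?R q \<phi>)) \<le> (\<Sum>q\<in>?Q. ?c)" .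
  qed
  also have "\<dots> = real (card ?Q) * (real (card V) ^ card ?U) ^ 2 / real (card V) ^ 2"
    using U by (simp add: card_PiE power2_eq_square)
  also have "\<dots> \<le> real (card ?U) ^ 4 * (real (card V) ^ card ?U) ^ 2 / real (card V) ^ 2"
    using cardQ by (intro divide_right_mono mult_right_mono) (simp_all flip: of_nat_power)
  finally show ?thesis .
qed

text \<open>A collision consists of two nodes and their common value, at most
  \<open>card U ^ 2 * card V\<close> choices, each of which prescribes two values.\<close>

lemma card_non_injective:
  assumes U: "finite U" and V: "finite V" "V \<noteq> {}"
  shows "real (card {\<phi> \<in> U \<rightarrow>\<^sub>E V. \<not> inj_on \<phi> U}) \<le> real (card U) ^ 2 * real (card V) ^ card U / real (card V)"
proof -
  let ?Q = "{(i, j). i \<in> U \<and> j \<in> U \<and> i \<noteq> j}"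
  let ?R = "\<lambda>x. {\<psi> \<in> U \<rightarrow>\<^sub>E V. \<psi> (fst (fst x)) = snd x \<and> \<psi> (snd (fst x)) = snd x}"
  let ?c = "real (card V) ^ card U / real (card V) ^ 2"
  have fin: "finite (U \<rightarrow>\<^sub>E V)" using U V by (auto intro: finite_PiE)
  have Q: "?Q \<subseteq> U \<times> U" by auto
  then have finQ: "finite ?Q" using U finite_subset by blast
  have cardQ: "card ?Q \<le> card U ^ 2"
    using card_mono[OF _ Q] U by (simp add: card_cartesian_product power2_eq_square)
  have "{\<phi> \<in> U \<rightarrow>\<^sub>E V. \<not> inj_on \<phi> U} \<subseteq> (\<Union>x\<in>?Q \<times> V. ?R x)"
    by (fastforce simp: inj_on_def)
  then have "card {\<phi> \<in> U \<rightarrow>\<^sub>E V. \<not> inj_on \<phi> U} \<le> card (\<Union>x\<in>?Q \<times> V. ?R x)"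
    using fin by (intro card_mono) (auto intro: finite_subset[of _ "U \<rightarrow>\<^sub>E V"])
  also have "\<dots> \<le> (\<Sum>x\<in>?Q \<times> V. card (?R x))"
    using finQ V by (intro card_UN_le) auto
  finally have "real (card {\<phi> \<in> U \<rightarrow>\<^sub>E V. \<not> inj_on \<phi> U}) \<le> (\<Sum>x\<in>?Q \<times> V. real (card (?R x)))"
    by (simp flip: of_nat_sum)
  also have "\<dots> \<le> (\<Sum>x\<in>?Q \<times> V. ?c)"
  proof (rule sum_mono)
    fix x assume "x \<in> ?Q \<times> V"
    then obtain i j a where x: "x = ((i, j), a)" "i \<in> U" "j \<in> U" "i \<noteq> j" "a \<in> V" by auto
    then have "card (?R x) * card V ^ 2 = card V ^ card U"
      using card_PiE_prescribe_two[OF U x(2-5,5)] by simp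
    then have "real (card (?R x)) * real (card V) ^ 2 = real (card V) ^ card U"
      by (simp flip: of_nat_power of_nat_mult)
    then show "real (card (?R x)) \<le> ?c"
      using V by (simp add: field_simps card_gt_0_iff)
  qed
  also have "\<dots> = real (card ?Q) * (real (card V) ^ card U / real (card V))"
    using V by (simp add: card_cartesian_product power2_eq_square)
  also have "\<dots> \<le> real (card U) ^ 2 * (real (card V) ^ card U / real (card V))"
    using cardQ by (intro mult_right_mono) (simp_all flip: of_nat_power)
  finally show ?thesis by simp
qed

section \<open>Asymptotics of the nonadjacency probability\<close>

text \<open>For \<open>k \<ge> 2\<close> the factor is \<open>(k - 2) / k\<close>, and the product
  telescopes over two steps. At \<open>k = 1\<close> the truncation makes the factor 0, in agreement
  with the factor \<open>real j - 1\<close>; for \<open>n = 1\<close> the right-hand side is a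
  division by zero, hence 0.\<close>

lemma prod_keep_nonadjacent:
  assumes "1 \<le> j" "j \<le> n"
  shows "(\<Prod>k = j..n. 1 - min 1 (2 / real k)) = (real j - 1) * (real j - 2) / (real n * (real n - 1))"
  using assms(2)
proof (induction n rule: dec_induct)
  case base
  consider "j = 1" | "j = 2" | "j \<ge> 3" using assms(1) by linarith
  then show ?case by cases (auto simp: min_def field_simps)
next
  case (step n)
  show ?case
  proof (cases "n = 1")
    case True
    then have "j = 1" using step assms by auto
    then show ?thesis using True by (simp add: numeral_eq_Suc)
  next
    case False
    with step assms have "n \<ge> 2" by auto
    then have "1 - min 1 (2 / real (Suc n)) = (real n - 1) / (real n + 1)"
      by (auto simp: min_def field_simps)
    moreover have "(\<Prod>k = j..Suc n. 1 - min 1 (2 / real k)) =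
        (1 - min 1 (2 / real (Suc n))) * (\<Prod>k = j..n. 1 - min 1 (2 / real k))"
      using step(1) by (intro prod.nat_ivl_Suc') simp
    ultimately have "(\<Prod>k = j..Suc n. 1 - min 1 (2 / real k)) =
        (real n - 1) / (real n + 1) * ((real j - 1) * (real j - 2) / (real n * (real n - 1)))"
      by (simp only: step(3))
    also have "\<dots> = (real j - 1) * (real j - 2) / (real (Suc n) * (real (Suc n) - 1))"
      using \<open>n \<ge> 2\<close> by (simp add: ac_simps)
    finally show ?thesis .
  qed
qed

lemma nonadj_approx:
  assumes "e \<in> vertex_pairs {..n}" "n \<ge> 2"
  shows "\<bar>nonadj n e - (\<Prod>i\<in>e. real i / real (Suc n))\<bar> \<le> 3 / (real n - 1)"
proof -
  obtain i j where ij: "e = {i, j}" "i < j" "j \<le> n"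
    using assms(1) unfolding vertex_pairs_eq by (auto simp: insert_commute) (metis insert_commute nat_neq_iff)
  let ?a = "(real j - 1) / real n" and ?b = "(real j - 2) / (real n - 1)" and ?c = "real j / (real n + 1)"
  have n: "real n \<ge> 2" and j: "real j \<ge> 1" "real j \<le> real n" using assms(2) ij by auto
  have "nonadj n e = real i / real j * (?a * ?b)"
  proof -
    have "Min e = i" "Max e = j" using ij by auto
    then show ?thesis using ij by (simp add: nonadj_def prod_keep_nonadjacent)
  qed
  moreover have "(\<Prod>i\<in>e. real i / real (Suc n)) = real i / real j * (?c * ?c)"
    using ij by (simp add: field_simps)
  ultimately have "\<bar>nonadj n e - (\<Prod>i\<in>e. real i / real (Suc n))\<bar> = real i / real j * \<bar>?a * ?b - ?c * ?c\<bar>"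
    by (simp only: abs_mult abs_divide abs_of_nat flip: right_diff_distrib)
  also have "\<dots> \<le> 1 * \<bar>?a * ?b - ?c * ?c\<bar>"
    using ij by (intro mult_right_mono) (auto simp: divide_le_eq)
  \<comment> \<open>One factor is exchanged at a time, with the weights \<open>?a\<close> and
    \<open>?c\<close>, which lie between 0 and 1; \<open>?b\<close> is negative for
    \<open>j = 1\<close> and would not do as a weight. The two exchanges cost
    \<open>2 / (real n - 1)\<close> and \<open>1 / (real n - 1)\<close>, whence the constant
    3.\<close>
  also have "?a * ?b - ?c * ?c = ?a * (?b - ?c) + ?c * (?a - ?c)"
    by (simp add: algebra_simps)
  also have "1 * \<bar>\<dots>\<bar> \<le> ?a * \<bar>?b - ?c\<bar> + ?c * \<bar>?a - ?c\<bar>"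
  proof -
    have "0 \<le> ?a" "0 \<le> ?c" using n j by simp_all
    then show ?thesis
      using abs_triangle_ineq[of "?a * (?b - ?c)" "?c * (?a - ?c)"]
      by (simp only: mult_1 abs_mult abs_of_nonneg)
  qed
  also have "\<dots> \<le> 1 * (2 / (real n - 1)) + 1 * (1 / (real n - 1))"
  proof (intro add_mono mult_mono)
    have "?c - ?b = 2 * (real n + 1 - real j) / ((real n - 1) * (real n + 1))"
      using n by (simp add: field_simps)
    moreover have "\<dots> \<le> 2 * (real n + 1) / ((real n - 1) * (real n + 1))"
      using n j by (intro divide_right_mono) auto
    moreover have "\<dots> = 2 / (real n - 1)"
      using n by (intro nonzero_mult_divide_mult_cancel_right) simp
    moreover have "0 \<le> 2 * (real n + 1 - real j) / ((real n - 1) * (real n + 1))"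
      using n j by simp
    ultimately show "\<bar>?b - ?c\<bar> \<le> 2 / (real n - 1)" by linarith
    have "?c - ?a = (real n + 1 - real j) / (real n * (real n + 1))"
      using n by (simp add: field_simps)
    moreover have "\<dots> \<le> (real n + 1) / (real n * (real n + 1))"
      using n j by (intro divide_right_mono) auto
    moreover have "\<dots> = 1 / real n" using n by simp
    moreover have "0 \<le> (real n + 1 - real j) / (real n * (real n + 1))"
      using n j by simp
    ultimately have "\<bar>?a - ?c\<bar> \<le> 1 / real n" by linarith
    also have "\<dots> \<le> 1 / (real n - 1)" using n by (simp add: field_simps)
    finally show "\<bar>?a - ?c\<bar> \<le> 1 / (real n - 1)" .
  qed (use n j in auto)
  also have "\<dots> = 3 / (real n - 1)" by (simp add: field_simps)
  finally show ?thesis .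
qed

subsection \<open>Riemann sums\<close>

text \<open>The cap puts the endpoint 1 into the last of the \<open>n + 1\<close> cells, where the
  floor alone would give \<open>n + 1\<close>.\<close>

definition cell :: "nat \<Rightarrow> real \<Rightarrow> nat" where
  "cell n x = min n (nat \<lfloor>real (Suc n) * x\<rfloor>)"

lemma cell_le: "cell n x \<le> n"
  by (simp add: cell_def)

lemma cell_tendsto:
  assumes "x \<in> {0..1}"
  shows "(\<lambda>n. real (cell n x) / real (Suc n)) \<longlonglongrightarrow> x"
proof -
  have bound: "x - 1 / real (Suc n) \<le> real (cell n x) / real (Suc n) \<and> real (cell n x) / real (Suc n) \<le> x" for n
  proof -
    let ?y = "real (Suc n) * x"
    have y: "0 \<le> ?y" "?y \<le> real (Suc n)"
      using assms mult_left_mono[of x 1 "real (Suc n)"] by auto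
    then have "real (nat \<lfloor>?y\<rfloor>) = of_int \<lfloor>?y\<rfloor>" by simp
    then have "real (nat \<lfloor>?y\<rfloor>) \<le> ?y" "?y - 1 \<le> real (nat \<lfloor>?y\<rfloor>)" by linarith+
    \<comment> \<open>The cap does not spoil the lower bound, because
      \<open>?y - 1 \<le> n\<close>.\<close>
    then have "real (cell n x) \<le> ?y" "?y - 1 \<le> real (cell n x)"
      using y unfolding cell_def of_nat_min of_nat_Suc by linarith+
    then have "(?y - 1) / real (Suc n) \<le> real (cell n x) / real (Suc n)"
      "real (cell n x) / real (Suc n) \<le> ?y / real (Suc n)"
      by (intro divide_right_mono; simp)+
    moreover have "?y / real (Suc n) = x" by simp
    ultimately show ?thesis by (simp only: diff_divide_distrib)
  qed
  have "(\<lambda>n. x - 1 / real (Suc n)) \<longlonglongrightarrow> x - 0"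
    by (intro tendsto_intros LIMSEQ_Suc[OF lim_1_over_n])
  then have lower: "(\<lambda>n. x - 1 / real (Suc n)) \<longlonglongrightarrow> x" by (simp only: diff_zero)
  show ?thesis
    by (rule tendsto_sandwich[OF _ _ lower tendsto_const[of x]])
      (intro always_eventually allI conjunct1[OF bound] conjunct2[OF bound])+
qed

lemma emeasure_cell:
  assumes "a \<le> n"
  shows "{x \<in> {0..1}. cell n x = a} \<in> sets (restrict_space lborel {0..1})"
    and "emeasure (restrict_space lborel {0..1}) {x \<in> {0..1}. cell n x = a} = ennreal (1 / real (Suc n))"
proof -
  let ?N = "real (Suc n)"
  have floor: "nat \<lfloor>?N * x\<rfloor> = a \<longleftrightarrow> real a \<le> ?N * x \<and> ?N * x < real a + 1" if "0 \<le> x" for x a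
  proof -
    have "nat \<lfloor>?N * x\<rfloor> = a \<longleftrightarrow> \<lfloor>?N * x\<rfloor> = int a" using that by (simp add: nat_eq_iff)
    then show ?thesis by (simp add: floor_eq_iff)
  qed
  \<comment> \<open>All cells are half-open except the last, which is closed since it contains 1;
    the lengths agree.\<close>
  have "{x \<in> {0..1}. cell n x = a} = (if a < n then {real a / ?N..<(real a + 1) / ?N} else {real a / ?N..1})"
  proof (cases "a < n")
    case True
    have "x \<in> {0..1} \<and> cell n x = a \<longleftrightarrow> x \<in> {real a / ?N..<(real a + 1) / ?N}" for x
    proof -
      have "cell n x = a \<longleftrightarrow> nat \<lfloor>?N * x\<rfloor> = a" using True by (auto simp: cell_def min_def)
      moreover have "x \<in> {real a / ?N..<(real a + 1) / ?N} \<longleftrightarrow> real a \<le> ?N * x \<and> ?N * x < real a + 1"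
        by (simp add: divide_le_eq less_divide_eq mult.commute)
      moreover have "x \<in> {0..1}" if "real a \<le> ?N * x" "?N * x < real a + 1"
      proof -
        have "0 \<le> ?N * x" using that(1) by (rule order.trans[rotated]) simp
        then have "0 \<le> x" by (simp add: zero_le_mult_iff)
        moreover have "x \<le> 1"
        proof (rule mult_left_le_imp_le)
          have "real a + 1 \<le> ?N" using True by simp
          then have "?N * x \<le> ?N" by (rule less_imp_le[OF less_le_trans[OF that(2)]])
          then show "?N * x \<le> ?N * 1" by (simp only: mult_1_right)
        qed simp
        ultimately show ?thesis by simp
      qed
      ultimately show ?thesis using floor[of x a] by (metis atLeastAtMost_iff)
    qed
    then show ?thesis using True by (simp only: if_True set_eq_iff mem_Collect_eq simp_thms)
  next
    case False
    then have a: "a = n" using assms by simp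
    have "cell n x = a \<longleftrightarrow> real a / ?N \<le> x" if "x \<in> {0..1}" for x
    proof -
      have "cell n x = a \<longleftrightarrow> n \<le> nat \<lfloor>?N * x\<rfloor>" using a by (auto simp: cell_def min_def)
      also have "\<dots> \<longleftrightarrow> int n \<le> \<lfloor>?N * x\<rfloor>" using that by (simp add: le_nat_iff)
      also have "\<dots> \<longleftrightarrow> real a / ?N \<le> x" by (simp add: le_floor_iff a divide_le_eq mult.commute)
      finally show ?thesis .
    qed
    moreover have "0 \<le> x" if "real a / ?N \<le> x" for x
      using that by (rule order.trans[rotated]) simp
    moreover have "x \<in> {real a / ?N..1} \<longleftrightarrow> real a / ?N \<le> x \<and> x \<le> 1" for x
      by (rule atLeastAtMost_iff)
    ultimately show ?thesis using False by (simp only: if_False set_eq_iff mem_Collect_eq) (metis atLeastAtMost_iff)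
  qed
  moreover have "real a / ?N \<le> 1" "(real a + 1) / ?N \<le> 1" if "a < n"
    using that by auto
  moreover have "1 - real n / ?N = 1 / ?N" by (simp add: field_simps)
  moreover have "(real a + 1) / ?N - real a / ?N = 1 / ?N" by (simp flip: diff_divide_distrib)
  moreover have "{x \<in> {0..1}. cell n x = a} \<subseteq> {0..1}" by auto
  ultimately show "{x \<in> {0..1}. cell n x = a} \<in> sets (restrict_space lborel {0..1})"
    and "emeasure (restrict_space lborel {0..1}) {x \<in> {0..1}. cell n x = a} = ennreal (1 / real (Suc n))"
    using assms
    by (cases "a < n"; simp add: sets_restrict_space_iff emeasure_restrict_space divide_right_mono)+
qed

lemma prob_space_unit: "prob_space (restrict_space lborel {0..1::real})"
  by (intro prob_space_restrict_space) auto

text \<open>The sum is the integral of a step function that takes on each box the value of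
  \<open>f\<close> at its lower corner. Continuity gives pointwise convergence, and the constant
  \<open>B\<close> dominates. Assumption \<open>cont\<close> looks only at coordinates in
  \<open>U\<close>, so the values of \<open>\<phi>\<close> elsewhere do no harm.\<close>

lemma riemann_sum_tendsto:
  fixes f :: "('v \<Rightarrow> real) \<Rightarrow> real"
  defines "\<Omega> \<equiv> \<lambda>U :: 'v set. \<Pi>\<^sub>M i\<in>U. restrict_space lborel {0..1}"
  assumes U: "finite U"
    and meas [measurable]: "f \<in> borel_measurable (\<Omega> U)"
    and bound: "\<And>x. (\<And>u. u \<in> U \<Longrightarrow> x u \<in> {0..1}) \<Longrightarrow> \<bar>f x\<bar> \<le> B"
    and cont: "\<And>y x. (\<And>u. u \<in> U \<Longrightarrow> (\<lambda>n. y n u) \<longlonglongrightarrow> x u) \<Longrightarrow> (\<lambda>n::nat. f (y n)) \<longlonglongrightarrow> f x"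
  shows "(\<lambda>n. (\<Sum>\<phi>\<in>U \<rightarrow>\<^sub>E {..n}. f (\<lambda>u. real (\<phi> u) / real (Suc n))) / real (Suc n) ^ card U)
    \<longlonglongrightarrow> (LINT x|\<Omega> U. f x)"
proof -
  interpret I: prob_space "restrict_space lborel {0..1::real}" by (rule prob_space_unit)
  interpret product_prob_space "\<lambda>_ :: 'v. restrict_space lborel {0..1::real}" U ..
  interpret Om: prob_space "\<Omega> U" unfolding \<Omega>_def by (rule prob_space_PiM) (rule prob_space_unit)
  let ?J = "\<lambda>n a. {x \<in> {0..1}. cell n x = a}"
  let ?box = "\<lambda>n \<phi>. PiE U (\<lambda>u. ?J n (\<phi> u))"
  let ?g = "\<lambda>n \<phi>. f (\<lambda>u. real (\<phi> u) / real (Suc n))"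
  define s where "s n x = (\<Sum>\<phi>\<in>U \<rightarrow>\<^sub>E {..n}. ?g n \<phi> * indicator (?box n \<phi>) x)" for n x
  have space: "space (\<Omega> U) = U \<rightarrow>\<^sub>E {0..1}"
    by (simp add: \<Omega>_def space_PiM space_restrict_space)
  have box: "?box n \<phi> \<in> sets (\<Omega> U)" "measure (\<Omega> U) (?box n \<phi>) = 1 / real (Suc n) ^ card U"
    if "\<phi> \<in> U \<rightarrow>\<^sub>E {..n}" for n \<phi>
  proof -
    have le: "\<phi> u \<le> n" if "u \<in> U" for u using \<open>\<phi> \<in> _\<close> that by auto
    show "?box n \<phi> \<in> sets (\<Omega> U)"
      unfolding \<Omega>_def using U le by (intro sets_PiM_I_finite emeasure_cell)
    have "emeasure (\<Omega> U) (?box n \<phi>) = (\<Prod>u\<in>U. ennreal (1 / real (Suc n)))"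
      unfolding \<Omega>_def using U le by (simp only: emeasure_PiM emeasure_cell cong: prod.cong)
    also have "\<dots> = ennreal ((1 / real (Suc n)) ^ card U)"
      by (simp only: prod_constant) (simp add: ennreal_power)
    finally show "measure (\<Omega> U) (?box n \<phi>) = 1 / real (Suc n) ^ card U"
      by (simp add: measure_def power_one_over)
  qed
  \<comment> \<open>The boxes partition the cube, so exactly one summand survives, the one indexed
    by the cells of the coordinates of \<open>x\<close>.\<close>
  have s: "s n x = f (\<lambda>u. real (restrict (\<lambda>u. cell n (x u)) U u) / real (Suc n))"
    if "x \<in> U \<rightarrow>\<^sub>E {0..1}" for n x
  proof -
    let ?c = "restrict (\<lambda>u. cell n (x u)) U"
    have "indicator (?box n \<phi>) x = (if \<phi> = ?c then 1 else 0 :: real)" if "\<phi> \<in> U \<rightarrow>\<^sub>E {..n}" for \<phi>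
    proof -
      have "x \<in> ?box n \<phi> \<longleftrightarrow> (\<forall>u\<in>U. cell n (x u) = \<phi> u)"
        using \<open>x \<in> _\<close> by (auto simp: PiE_iff)
      also have "\<dots> \<longleftrightarrow> \<phi> = ?c"
        using that by (auto simp: PiE_iff extensional_def fun_eq_iff)
      finally show ?thesis by (simp add: indicator_def)
    qed
    then have "s n x = (\<Sum>\<phi>\<in>U \<rightarrow>\<^sub>E {..n}. if \<phi> = ?c then ?g n \<phi> else 0)"
      unfolding s_def by (intro sum.cong) auto
    moreover have "?c \<in> U \<rightarrow>\<^sub>E {..n}" by (auto simp: cell_le)
    ultimately show ?thesis using U by (simp add: finite_PiE)
  qed
  have "(LINT x|\<Omega> U. s n x) = (\<Sum>\<phi>\<in>U \<rightarrow>\<^sub>E {..n}. ?g n \<phi>) / real (Suc n) ^ card U" for n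
  proof -
    have "(LINT x|\<Omega> U. s n x) = (\<Sum>\<phi>\<in>U \<rightarrow>\<^sub>E {..n}. LINT x|\<Omega> U. ?g n \<phi> * indicator (?box n \<phi>) x)"
      unfolding s_def using box by (intro Bochner_Integration.integral_sum) (simp add: Om.emeasure_eq_measure)
    also have "\<dots> = (\<Sum>\<phi>\<in>U \<rightarrow>\<^sub>E {..n}. ?g n \<phi> * (1 / real (Suc n) ^ card U))"
      using box by (intro sum.cong refl) (simp add: Int_absorb1[OF sets.sets_into_space] Int_commute)
    finally show ?thesis by (simp add: sum_divide_distrib)
  qed
  moreover have "(\<lambda>n. LINT x|\<Omega> U. s n x) \<longlonglongrightarrow> (LINT x|\<Omega> U. f x)"
  proof (rule integral_dominated_convergence[where w = "\<lambda>_. B"])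
    show "s n \<in> borel_measurable (\<Omega> U)" for n
      unfolding s_def using box(1) by (intro borel_measurable_sum borel_measurable_times) auto
    show "AE x in \<Omega> U. (\<lambda>n. s n x) \<longlonglongrightarrow> f x"
    proof (rule AE_I2)
      fix x assume "x \<in> space (\<Omega> U)"
      then have x: "x \<in> U \<rightarrow>\<^sub>E {0..1}" by (simp add: space)
      show "(\<lambda>n. s n x) \<longlonglongrightarrow> f x"
        unfolding s[OF x]
      proof (rule cont)
        fix u assume "u \<in> U"
        then show "(\<lambda>n. real (restrict (\<lambda>u. cell n (x u)) U u) / real (Suc n)) \<longlonglongrightarrow> x u"
          using cell_tendsto[OF PiE_mem[OF x]] by simp
      qed
    qed
    show "AE x in \<Omega> U. norm (s n x) \<le> B" for n
    proof (rule AE_I2)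
      fix x assume "x \<in> space (\<Omega> U)"
      then have x: "x \<in> U \<rightarrow>\<^sub>E {0..1}" by (simp add: space)
      show "norm (s n x) \<le> B"
        unfolding s[OF x] real_norm_def
      proof (rule bound)
        fix u assume "u \<in> U"
        moreover have "real (cell n (x u)) \<le> real (Suc n)"
          unfolding of_nat_le_iff by (rule le_SucI[OF cell_le])
        ultimately show "real (restrict (\<lambda>u. cell n (x u)) U u) / real (Suc n) \<in> {0..1}"
          by simp
      qed
    qed
  qed (auto simp: Om.integrable_const)
  ultimately show ?thesis by simp
qed

section \<open>The integrand attached to a graph\<close>

text \<open>The product over the set \<open>e\<close> does not depend on an order of its two ends,
  which resolves the definite description in \<open>edge_value\<close>.\<close>

lemma edge_value_eq:
  assumes "e \<in> vertex_pairs V"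
  shows "edge_value (\<lambda>x y. 1 - x * y) x e = 1 - (\<Prod>i\<in>e. x i)"
proof -
  obtain i j where e: "e = {i, j}" "i \<noteq> j" using assms by (auto simp: vertex_pairs_eq)
  show ?thesis
    unfolding edge_value_def
  proof (rule the_equality)
    show "\<exists>i j. e = {i, j} \<and> 1 - (\<Prod>i\<in>e. x i) = 1 - x i * x j"
      using e by (intro exI[of _ i] exI[of _ j]) simp
  next
    fix w assume "\<exists>i j. e = {i, j} \<and> w = 1 - x i * x j"
    then obtain k l where kl: "e = {k, l}" "w = 1 - x k * x l" by blast
    then have "k \<noteq> l" using e by auto
    then show "w = 1 - (\<Prod>i\<in>e. x i)" using kl by simp
  qed
qed

definition edge_product :: "'v graph \<Rightarrow> ('v \<Rightarrow> real) \<Rightarrow> real" where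
  "edge_product F x = (\<Prod>e\<in>edges F. 1 - (\<Prod>i\<in>e. x i))"

lemma kernel_density_eq:
  assumes "finite_simple_graph F"
  shows "kernel_density F (\<lambda>x y. 1 - x * y) =
    (LINT x|(\<Pi>\<^sub>M i\<in>verts F. restrict_space lborel {0..1}). edge_product F x)"
  unfolding kernel_density_def edge_product_def
  using assms by (intro Bochner_Integration.integral_cong prod.cong refl edge_value_eq)
    (auto simp: finite_simple_graph_def)

lemma edge_factor_bounds:
  fixes x :: "'v \<Rightarrow> real"
  assumes "e \<subseteq> V" "\<And>u. u \<in> V \<Longrightarrow> x u \<in> {0..1}"
  shows "1 - (\<Prod>i\<in>e. x i) \<in> {0..1}"
proof -
  have "\<And>i. i \<in> e \<Longrightarrow> 0 \<le> x i \<and> x i \<le> 1" using assms by fastforce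
  then have "0 \<le> (\<Prod>i\<in>e. x i)" "(\<Prod>i\<in>e. x i) \<le> 1" by (auto intro: prod_nonneg prod_le_1)
  then show ?thesis by simp
qed

lemma edges_subset: "finite_simple_graph F \<Longrightarrow> e \<in> edges F \<Longrightarrow> e \<subseteq> verts F"
  by (auto simp: finite_simple_graph_def vertex_pairs_def)

lemma edge_product_bounds:
  assumes "finite_simple_graph F" "\<And>u. u \<in> verts F \<Longrightarrow> x u \<in> {0..1}"
  shows "edge_product F x \<in> {0..1}"
proof -
  have "1 - (\<Prod>i\<in>e. x i) \<in> {0..1}" if "e \<in> edges F" for e
    using edge_factor_bounds[OF edges_subset[OF assms(1) that] assms(2)] .
  then show ?thesis unfolding edge_product_def by (auto intro!: prod_nonneg prod_le_1)
qed

lemma riemann_sum_edge_product: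
  assumes F: "finite_simple_graph F"
  shows "(\<lambda>n. (\<Sum>\<phi>\<in>verts F \<rightarrow>\<^sub>E {..n}. edge_product F (\<lambda>u. real (\<phi> u) / real (Suc n)))
      / real (Suc n) ^ card (verts F))
    \<longlonglongrightarrow> kernel_density F (\<lambda>x y. 1 - x * y)"
  unfolding kernel_density_eq[OF F]
proof (rule riemann_sum_tendsto[where B = 1])
  let ?\<Omega> = "\<Pi>\<^sub>M i\<in>verts F. restrict_space lborel {0..1::real}"
  show "finite (verts F)" using F by (simp add: finite_simple_graph_def)
  have component: "(\<lambda>x. x i) \<in> borel_measurable ?\<Omega>" if "i \<in> verts F" for i
  proof (rule measurable_compose[OF measurable_component_singleton[OF that]])
    show "(\<lambda>x. x) \<in> borel_measurable (restrict_space lborel {0..1::real})"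
      by (intro measurable_restrict_space1) simp
  qed
  then show "edge_product F \<in> borel_measurable ?\<Omega>"
    unfolding edge_product_def using edges_subset[OF F]
    by (intro borel_measurable_prod borel_measurable_diff borel_measurable_const) blast
  show "\<bar>edge_product F x\<bar> \<le> 1" if "\<And>u. u \<in> verts F \<Longrightarrow> x u \<in> {0..1}" for x
    using edge_product_bounds[OF F that] by simp
  show "(\<lambda>n. edge_product F (y n)) \<longlonglongrightarrow> edge_product F x"
    if "\<And>u. u \<in> verts F \<Longrightarrow> (\<lambda>n. y n u) \<longlonglongrightarrow> x u" for y x
    unfolding edge_product_def using edges_subset[OF F] that
    by (intro tendsto_prod tendsto_diff tendsto_const) blast
qed

subsection \<open>Convergence of homomorphism densities\<close>

text \<open>The value 0 is meant for singletons, the images of edges whose ends are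
  identified.\<close>

definition edge_prob :: "nat \<Rightarrow> nat set \<Rightarrow> real" where
  "edge_prob n s = (if s \<in> vertex_pairs {..n} then 1 - nonadj n s else 0)"

lemma edge_prob_bounds: "0 \<le> edge_prob n s" "edge_prob n s \<le> 1"
  using nonadj_bounds[of s "{..n}" n] by (auto simp: edge_prob_def)

text \<open>The expectation of \<open>hom_density F\<close> under \<open>ra_law n\<close>. The
  product runs over the set of image pairs, since edges with the same image depend on one and the
  same coin.\<close>

definition mean_density :: "'v graph \<Rightarrow> nat \<Rightarrow> real" where
  "mean_density F n =
    (\<Sum>\<phi>\<in>verts F \<rightarrow>\<^sub>E {..n}. \<Prod>s\<in>(`) \<phi> ` edges F. edge_prob n s) / real (Suc n) ^ card (verts F)"

lemma finite_edges: "finite_simple_graph F \<Longrightarrow> finite (edges F)"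
  by (auto simp: finite_simple_graph_def intro: finite_subset)

lemma hom_density_ra_graph:
  assumes F: "finite_simple_graph F"
  shows "hom_density F (ra_graph n E) =
    (\<Sum>\<phi>\<in>verts F \<rightarrow>\<^sub>E {..n}. of_bool ((`) \<phi> ` edges F \<subseteq> E)) / real (Suc n) ^ card (verts F)"
proof -
  have "(\<forall>i j. {i, j} \<in> edges F \<longrightarrow> {\<phi> i, \<phi> j} \<in> E) \<longleftrightarrow> (`) \<phi> ` edges F \<subseteq> E" for \<phi> :: "'a \<Rightarrow> nat"
  proof
    assume *: "\<forall>i j. {i, j} \<in> edges F \<longrightarrow> {\<phi> i, \<phi> j} \<in> E"
    show "(`) \<phi> ` edges F \<subseteq> E"
    proof
      fix s assume "s \<in> (`) \<phi> ` edges F"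
      then obtain e where "e \<in> edges F" "s = \<phi> ` e" by blast
      moreover from this(1) obtain i j where "e = {i, j}"
        using F unfolding finite_simple_graph_def vertex_pairs_eq by blast
      ultimately show "s \<in> E" using * by simp
    qed
  next
    assume *: "(`) \<phi> ` edges F \<subseteq> E"
    have "{\<phi> i, \<phi> j} \<in> E" if "{i, j} \<in> edges F" for i j
      using subsetD[OF * imageI[OF that]] by simp
    then show "\<forall>i j. {i, j} \<in> edges F \<longrightarrow> {\<phi> i, \<phi> j} \<in> E" by blast
  qed
  then have "homs F (ra_graph n E) = (verts F \<rightarrow>\<^sub>E {..n}) \<inter> {\<phi>. (`) \<phi> ` edges F \<subseteq> E}"
    by (auto simp: homs_def)
  moreover have "finite (verts F \<rightarrow>\<^sub>E {..n})"
    using F by (auto simp: finite_simple_graph_def intro: finite_PiE)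
  ultimately show ?thesis
    unfolding hom_density_def by (simp add: of_bool_def sum.If_cases)
qed

lemma variance_hom_density:
  assumes F: "finite_simple_graph F"
  shows "measure_pmf.expectation (ra_law n) (\<lambda>g. (hom_density F g - mean_density F n)\<^sup>2)
    \<le> real (card (verts F)) ^ 4 / real (Suc n) ^ 2"
proof -
  let ?\<Phi> = "verts F \<rightarrow>\<^sub>E {..n}" and ?N = "real (Suc n) ^ card (verts F)"
  let ?S = "\<lambda>\<phi>. (`) \<phi> ` edges F"
  let ?P = "bernoulli_set (vertex_pairs {..n}) (\<lambda>e. 1 - nonadj n e)"
  have fin: "finite ?\<Phi>"
    using F by (auto simp: finite_simple_graph_def intro: finite_PiE)
  have "hom_density F (ra_graph n E) - mean_density F n =
      (\<Sum>\<phi>\<in>?\<Phi>. of_bool (?S \<phi> \<subseteq> E) - (\<Prod>s\<in>?S \<phi>. edge_prob n s)) / ?N" for E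
    by (simp only: hom_density_ra_graph[OF F] mean_density_def sum_subtractf diff_divide_distrib)
  then have "measure_pmf.expectation (ra_law n) (\<lambda>g. (hom_density F g - mean_density F n)\<^sup>2) =
      measure_pmf.expectation ?P
        (\<lambda>E. (\<Sum>\<phi>\<in>?\<Phi>. of_bool (?S \<phi> \<subseteq> E) - (\<Prod>s\<in>?S \<phi>. edge_prob n s))\<^sup>2) / ?N\<^sup>2"
    by (simp only: ra_law_def integral_map_pmf power_divide integral_divide_zero)
  also have "\<dots> \<le> real (card {(\<phi>, \<psi>) \<in> ?\<Phi> \<times> ?\<Phi>. ?S \<phi> \<inter> ?S \<psi> \<inter> vertex_pairs {..n} \<noteq> {}}) / ?N\<^sup>2"
    unfolding edge_prob_def
  proof (intro divide_right_mono bernoulli_set_variance fin)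
    show "1 - nonadj n e \<in> {0..1}" if "e \<in> vertex_pairs {..n}" for e
      using nonadj_bounds[OF that, of n] by simp
  qed (simp_all add: finite_edges[OF F])
  also have "\<dots> \<le> real (card (verts F)) ^ 4 * ?N ^ 2 / real (Suc n) ^ 2 / ?N\<^sup>2"
    using card_overlapping_pairs[OF F, of "{..n}"] by (intro divide_right_mono) simp_all
  also have "\<dots> = real (card (verts F)) ^ 4 / real (Suc n) ^ 2"
    by simp
  finally show ?thesis .
qed

text \<open>Injectivity keeps the images of different edges different, so the product can be taken
  over the edges of \<open>F\<close>. All factors are bounded by 1 in absolute value, hence the
  products differ by at most the sum of the differences of the factors.\<close>

lemma mean_summand_approx:
  assumes F: "finite_simple_graph F" and \<phi>: "\<phi> \<in> verts F \<rightarrow>\<^sub>E {..n}" "inj_on \<phi> (verts F)" and n: "n \<ge> 2"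
  shows "\<bar>(\<Prod>s\<in>(`) \<phi> ` edges F. edge_prob n s) - edge_product F (\<lambda>u. real (\<phi> u) / real (Suc n))\<bar>
    \<le> real (card (edges F)) * (3 / (real n - 1))"
proof -
  let ?x = "\<lambda>u. real (\<phi> u) / real (Suc n)"
  have inj_e: "inj_on \<phi> e" if "e \<in> edges F" for e
    using edges_subset[OF F that] \<phi>(2) inj_on_subset by blast
  have "inj_on ((`) \<phi>) (edges F)"
    using \<phi>(2) edges_subset[OF F] by (intro inj_onI) (metis inj_on_image_eq_iff)
  then have "(\<Prod>s\<in>(`) \<phi> ` edges F. edge_prob n s) = (\<Prod>e\<in>edges F. edge_prob n (\<phi> ` e))"
    by (simp add: prod.reindex)
  then have "\<bar>(\<Prod>s\<in>(`) \<phi> ` edges F. edge_prob n s) - edge_product F ?x\<bar> =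
      norm ((\<Prod>e\<in>edges F. edge_prob n (\<phi> ` e)) - (\<Prod>e\<in>edges F. 1 - (\<Prod>i\<in>e. ?x i)))"
    by (simp only: edge_product_def real_norm_def)
  also have "\<dots> \<le> (\<Sum>e\<in>edges F. norm (edge_prob n (\<phi> ` e) - (1 - (\<Prod>i\<in>e. ?x i))))"
  proof (rule norm_prod_diff)
    show "norm (edge_prob n (\<phi> ` e)) \<le> 1" for e
      using edge_prob_bounds[of n "\<phi> ` e"] by simp
    fix e assume "e \<in> edges F"
    have "?x u \<in> {0..1}" if "u \<in> verts F" for u
    proof -
      have "\<phi> u \<le> n" using \<phi>(1) that by auto
      then show ?thesis by simp
    qed
    from edge_factor_bounds[OF edges_subset[OF F \<open>e \<in> edges F\<close>] this]
    show "norm (1 - (\<Prod>i\<in>e. ?x i)) \<le> 1" by (simp only: atLeastAtMost_iff real_norm_def abs_of_nonneg)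
  qed
  also have "\<dots> \<le> (\<Sum>e\<in>edges F. 3 / (real n - 1))"
  proof (rule sum_mono)
    fix e assume e: "e \<in> edges F"
    have "card (\<phi> ` e) = 2" "\<phi> ` e \<subseteq> {..n}"
      using e F \<phi>(1) edges_subset[OF F e] card_image[OF inj_e[OF e]]
      by (auto simp: finite_simple_graph_def vertex_pairs_def)
    then have pair: "\<phi> ` e \<in> vertex_pairs {..n}" by (simp add: vertex_pairs_def)
    have "(\<Prod>i\<in>\<phi> ` e. real i / real (Suc n)) = (\<Prod>i\<in>e. ?x i)"
      by (simp only: prod.reindex[OF inj_e[OF e]] o_def)
    then have "edge_prob n (\<phi> ` e) - (1 - (\<Prod>i\<in>e. ?x i)) =
        - (nonadj n (\<phi> ` e) - (\<Prod>i\<in>\<phi> ` e. real i / real (Suc n)))"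
      using pair by (simp only: edge_prob_def if_True)
    then show "norm (edge_prob n (\<phi> ` e) - (1 - (\<Prod>i\<in>e. ?x i))) \<le> 3 / (real n - 1)"
      using nonadj_approx[OF pair n] by (simp only: norm_minus_cancel real_norm_def)
  qed
  finally show ?thesis by simp
qed

lemma mean_density_approx:
  assumes F: "finite_simple_graph F" and n: "n \<ge> 2"
  shows "\<bar>mean_density F n -
      (\<Sum>\<phi>\<in>verts F \<rightarrow>\<^sub>E {..n}. edge_product F (\<lambda>u. real (\<phi> u) / real (Suc n))) / real (Suc n) ^ card (verts F)\<bar>
    \<le> real (card (edges F)) * (3 / (real n - 1)) + real (card (verts F)) ^ 2 / real (Suc n)"
proof -
  let ?\<Phi> = "verts F \<rightarrow>\<^sub>E {..n}" and ?N = "real (Suc n) ^ card (verts F)"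
  let ?a = "\<lambda>\<phi>. \<Prod>s\<in>(`) \<phi> ` edges F. edge_prob n s"
  let ?b = "\<lambda>\<phi>. edge_product F (\<lambda>u. real (\<phi> u) / real (Suc n))"
  let ?c = "real (card (edges F)) * (3 / (real n - 1))"
  let ?D = "{\<phi> \<in> ?\<Phi>. \<not> inj_on \<phi> (verts F)}"
  have U: "finite (verts F)" using F by (simp add: finite_simple_graph_def)
  then have fin: "finite ?\<Phi>" by (auto intro: finite_PiE)
  have c: "0 \<le> ?c" using n by simp
  \<comment> \<open>For maps that are not injective the trivial bound 1 is affordable, because
    \<open>card_non_injective\<close> makes them a fraction of order \<open>1/n\<close>.\<close>
  have le: "\<bar>?a \<phi> - ?b \<phi>\<bar> \<le> ?c + of_bool (\<phi> \<in> ?D)" if "\<phi> \<in> ?\<Phi>" for \<phi>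
  proof (cases "inj_on \<phi> (verts F)")
    case True
    then show ?thesis using mean_summand_approx[OF F that True n] by simp
  next
    case False
    have "real (\<phi> u) / real (Suc n) \<in> {0..1}" if "u \<in> verts F" for u
    proof -
      have "\<phi> u \<le> n" using \<open>\<phi> \<in> ?\<Phi>\<close> that by auto
      then show ?thesis by simp
    qed
    from edge_product_bounds[OF F this] have "0 \<le> ?b \<phi>" "?b \<phi> \<le> 1" by (simp_all only: atLeastAtMost_iff)
    moreover have "0 \<le> ?a \<phi>" "?a \<phi> \<le> 1"
      by (intro prod_nonneg prod_le_1; simp add: edge_prob_bounds)+
    ultimately have "\<bar>?a \<phi> - ?b \<phi>\<bar> \<le> 1" by linarith
    moreover have "of_bool (\<phi> \<in> ?D) = (1 :: real)" using False that by simp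
    ultimately show ?thesis using c by linarith
  qed
  have "\<bar>mean_density F n - (\<Sum>\<phi>\<in>?\<Phi>. ?b \<phi>) / ?N\<bar> = \<bar>\<Sum>\<phi>\<in>?\<Phi>. ?a \<phi> - ?b \<phi>\<bar> / ?N"
    unfolding mean_density_def by (simp add: sum_subtractf flip: diff_divide_distrib)
  also have "\<dots> \<le> (\<Sum>\<phi>\<in>?\<Phi>. ?c + of_bool (\<phi> \<in> ?D)) / ?N"
    by (intro divide_right_mono order.trans[OF sum_abs] sum_mono le) simp_all
  also have "(\<Sum>\<phi>\<in>?\<Phi>. ?c + of_bool (\<phi> \<in> ?D)) = ?N * ?c + real (card ?D)"
  proof -
    have D: "?\<Phi> \<inter> {\<phi>. \<phi> \<in> ?D} = ?D" by auto
    have "(\<Sum>\<phi>\<in>?\<Phi>. of_bool (\<phi> \<in> ?D)) = real (card ?D)"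
      by (subst sum_of_bool_eq) (simp_all only: fin D)
    moreover have "real (card ?\<Phi>) = ?N" using U by (simp add: card_PiE)
    ultimately show ?thesis by (simp only: sum.distrib sum_constant)
  qed
  also have "\<dots> / ?N \<le> (?N * ?c + real (card (verts F)) ^ 2 * ?N / real (Suc n)) / ?N"
    using card_non_injective[OF U, of "{..n}"] by (intro divide_right_mono add_left_mono) simp_all
  also have "\<dots> = ?c + real (card (verts F)) ^ 2 / real (Suc n)"
    by (simp add: add_divide_distrib)
  finally show ?thesis .
qed

lemma mean_density_tendsto:
  assumes F: "finite_simple_graph F"
  shows "mean_density F \<longlonglongrightarrow> kernel_density F (\<lambda>x y. 1 - x * y)"
proof -
  let ?r = "\<lambda>n. (\<Sum>\<phi>\<in>verts F \<rightarrow>\<^sub>E {..n}. edge_product F (\<lambda>u. real (\<phi> u) / real (Suc n)))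
    / real (Suc n) ^ card (verts F)"
  have "(\<lambda>n. real (card (edges F)) * (3 / (real n - 1)) + real (card (verts F)) ^ 2 / real (Suc n)) \<longlonglongrightarrow> 0"
    by real_asymp
  then have "(\<lambda>n. mean_density F n - ?r n) \<longlonglongrightarrow> 0"
    by (rule Lim_null_comparison[rotated])
      (use mean_density_approx[OF F] in \<open>auto intro!: eventually_sequentiallyI[of 2]\<close>)
  from tendsto_add[OF this riemann_sum_edge_product[OF F]] show ?thesis by simp
qed

text \<open>By monotone convergence the sum of the squares has finite expectation, so it is finite
  almost surely and its terms tend to 0. The variables may depend on each other in any way.\<close>

lemma (in prob_space) AE_tendsto_0_of_summable_moment:
  fixes Z :: "nat \<Rightarrow> 'a \<Rightarrow> real"
  assumes [measurable]: "\<And>n. Z n \<in> borel_measurable M"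
    and bound: "\<And>n. (\<integral>\<^sup>+ \<omega>. ennreal ((Z n \<omega>)\<^sup>2) \<partial>M) \<le> ennreal (c n)"
    and c: "\<And>n. 0 \<le> c n" "summable c"
  shows "AE \<omega> in M. (\<lambda>n. Z n \<omega>) \<longlonglongrightarrow> 0"
proof -
  have "(\<integral>\<^sup>+ \<omega>. (\<Sum>n. ennreal ((Z n \<omega>)\<^sup>2)) \<partial>M) = (\<Sum>n. \<integral>\<^sup>+ \<omega>. ennreal ((Z n \<omega>)\<^sup>2) \<partial>M)"
    by (rule nn_integral_suminf) simp
  also have "\<dots> \<le> (\<Sum>n. ennreal (c n))"
    by (intro suminf_le bound) auto
  also have "\<dots> < top"
    using c by (simp add: suminf_ennreal2)
  finally have "(\<integral>\<^sup>+ \<omega>. (\<Sum>n. ennreal ((Z n \<omega>)\<^sup>2)) \<partial>M) \<noteq> \<infinity>" by simp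
  then have "AE \<omega> in M. (\<Sum>n. ennreal ((Z n \<omega>)\<^sup>2)) \<noteq> \<infinity>"
    by (intro nn_integral_PInf_AE) simp_all
  then show ?thesis
  proof (rule AE_mp, intro AE_I2 impI)
    fix \<omega> assume "(\<Sum>n. ennreal ((Z n \<omega>)\<^sup>2)) \<noteq> \<infinity>"
    then have "summable (\<lambda>n. (Z n \<omega>)\<^sup>2)"
      by (intro summable_suminf_not_top) simp_all
    then have "(\<lambda>n. sqrt ((Z n \<omega>)\<^sup>2)) \<longlonglongrightarrow> sqrt 0"
      by (intro tendsto_real_sqrt summable_LIMSEQ_zero)
    then show "(\<lambda>n. Z n \<omega>) \<longlonglongrightarrow> 0"
      by (simp add: tendsto_rabs_zero_iff)
  qed
qed

lemma (in ra_graph_sequence) AE_hom_density_tendsto: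
  assumes F: "finite_simple_graph F"
  shows "AE \<omega> in M. (\<lambda>n. hom_density F (G n \<omega>)) \<longlonglongrightarrow> kernel_density F (\<lambda>x y. 1 - x * y)"
proof -
  let ?Z = "\<lambda>n \<omega>. hom_density F (G n \<omega>) - mean_density F n"
  let ?c = "\<lambda>n. real (card (verts F)) ^ 4 * inverse (real (Suc n) ^ 2)"
  have "AE \<omega> in M. (\<lambda>n. ?Z n \<omega>) \<longlonglongrightarrow> 0"
  proof (rule AE_tendsto_0_of_summable_moment)
    fix n
    show "?Z n \<in> borel_measurable M"
      by (intro borel_measurable_diff measurable_compose[OF random_graph]) auto
    have fin: "finite (set_pmf (ra_law n))"
    proof -
      have "set_pmf (bernoulli_set (vertex_pairs {..n}) p) \<subseteq> Pow (vertex_pairs {..n})" for p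
        using bernoulli_set_subset[of "vertex_pairs {..n}"] by auto
      then have "finite (set_pmf (bernoulli_set (vertex_pairs {..n}) p))" for p
        by (rule finite_subset) simp
      then show ?thesis by (simp add: ra_law_def)
    qed
    have "(\<integral>\<^sup>+ \<omega>. ennreal ((?Z n \<omega>)\<^sup>2) \<partial>M) =
        (\<integral>\<^sup>+ g. ennreal ((hom_density F g - mean_density F n)\<^sup>2) \<partial>distr M (count_space UNIV) (G n))"
      by (subst nn_integral_distr) (simp_all add: random_graph)
    also have "\<dots> = ennreal (measure_pmf.expectation (ra_law n) (\<lambda>g. (hom_density F g - mean_density F n)\<^sup>2))"
      unfolding distr_graph
      by (intro nn_integral_eq_integral integrable_measure_pmf_finite fin) simp
    also have "\<dots> \<le> ennreal (?c n)"
      using variance_hom_density[OF F, of n] by (intro ennreal_leI) (simp add: divide_inverse)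
    finally show "(\<integral>\<^sup>+ \<omega>. ennreal ((?Z n \<omega>)\<^sup>2) \<partial>M) \<le> ennreal (?c n)" .
  next
    have "summable (\<lambda>n. inverse (real (Suc n) ^ 2))"
      using inverse_power_summable[of 2, where 'a = real] by (subst summable_Suc_iff) simp
    then show "summable ?c" by (rule summable_mult)
  qed simp
  then show ?thesis
  proof (rule AE_mp, intro AE_I2 impI)
    fix \<omega> assume "(\<lambda>n. ?Z n \<omega>) \<longlonglongrightarrow> 0"
    from tendsto_add[OF this mean_density_tendsto[OF F]]
    show "(\<lambda>n. hom_density F (G n \<omega>)) \<longlonglongrightarrow> kernel_density F (\<lambda>x y. 1 - x * y)" by simp
  qed
qed

text \<open>Precomposition with \<open>h\<close> matches the homomorphisms from \<open>F\<close>
  with those from the graph pulled back to \<open>V\<close>. This moves a graph over an arbitrary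
  type to an initial segment of the natural numbers.\<close>

lemma hom_density_relabel:
  fixes F :: "'v graph" and G :: "'w graph"
  assumes F: "finite_simple_graph F" and h: "bij_betw h V (verts F)"
  defines "F' \<equiv> \<lparr>verts = V, edges = {e \<in> vertex_pairs V. h ` e \<in> edges F}\<rparr>"
  shows "hom_density F G = hom_density F' G"
proof -
  let ?k = "inv_into V h"
  have hk: "h (?k u) = u" "?k u \<in> V" if "u \<in> verts F" for u
    using that h by (auto simp: bij_betw_def f_inv_into_f inv_into_into)
  have kh: "?k (h v) = v" "h v \<in> verts F" if "v \<in> V" for v
    using that h by (auto simp: bij_betw_def)
  have edge: "{i, j} \<in> edges F' \<longleftrightarrow> i \<in> V \<and> j \<in> V \<and> {h i, h j} \<in> edges F" for i j
  proof -
    have "i \<noteq> j" if "{h i, h j} \<in> edges F"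
      using that F by (auto simp: finite_simple_graph_def vertex_pairs_def)
    then show ?thesis by (auto simp: F'_def vertex_pairs_def card_2_iff)
  qed
  have verts: "i \<in> verts F \<and> j \<in> verts F" if "{i, j} \<in> edges F" for i j
    using edges_subset[OF F that] by simp
  have "bij_betw (\<lambda>\<phi>. restrict (\<phi> \<circ> h) V) (homs F G) (homs F' G)"
  proof (rule bij_betw_byWitness[where f' = "\<lambda>\<psi>. restrict (\<psi> \<circ> ?k) (verts F)"])
    show "\<forall>\<phi>\<in>homs F G. restrict (restrict (\<phi> \<circ> h) V \<circ> ?k) (verts F) = \<phi>"
      by (auto simp: homs_def hk fun_eq_iff PiE_iff extensional_def)
    show "\<forall>\<psi>\<in>homs F' G. restrict (restrict (\<psi> \<circ> ?k) (verts F) \<circ> h) V = \<psi>"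
      by (auto simp: homs_def kh fun_eq_iff PiE_iff extensional_def F'_def)
    show "(\<lambda>\<phi>. restrict (\<phi> \<circ> h) V) ` homs F G \<subseteq> homs F' G"
      using kh by (auto simp: homs_def edge) (auto simp: F'_def)
    show "(\<lambda>\<psi>. restrict (\<psi> \<circ> ?k) (verts F)) ` homs F' G \<subseteq> homs F G"
      using hk verts by (auto simp: homs_def edge) (auto simp: F'_def)
  qed
  then show ?thesis
    using bij_betw_same_card[OF h] by (simp add: hom_density_def bij_betw_same_card F'_def)
qed

theorem theorem3p2:
  fixes M :: "'a measure" and G :: "nat \<Rightarrow> 'a \<Rightarrow> nat graph"
  assumes "ra_graph_sequence M G"
  shows "AE \<omega> in M. \<forall>F :: 'v graph. finite_simple_graph F \<longrightarrow>
    (\<lambda>n. hom_density F (G n \<omega>)) \<longlonglongrightarrow> kernel_density F (\<lambda>x y. 1 - x * y)"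
proof -
  interpret ra_graph_sequence M G by fact
  let ?t = "\<lambda>F. kernel_density F (\<lambda>x y. 1 - x * y)"
  \<comment> \<open>A countable family that contains an isomorphic copy of every finite simple
    graph, so one null set serves all \<open>F\<close>, even if \<open>'v\<close> is
    uncountable.\<close>
  let ?C = "\<Union>k :: nat. (\<lambda>E. \<lparr>verts = {..<k}, edges = E\<rparr>) ` Pow (vertex_pairs {..<k})"
  have "countable ?C"
    by (intro countable_UN countable_image) (simp_all add: countable_finite)
  moreover have C: "finite_simple_graph H" if "H \<in> ?C" for H
    using that by (auto simp: finite_simple_graph_def)
  ultimately have "AE \<omega> in M. \<forall>H\<in>?C. (\<lambda>n. hom_density H (G n \<omega>)) \<longlonglongrightarrow> ?t H"
    by (intro AE_ball_countable' AE_hom_density_tendsto)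
  then show ?thesis
  proof (rule AE_mp, intro AE_I2 impI allI)
    fix \<omega> and F :: "'v graph"
    assume lim: "\<forall>H\<in>?C. (\<lambda>n. hom_density H (G n \<omega>)) \<longlonglongrightarrow> ?t H" and F: "finite_simple_graph F"
    then obtain h where h: "bij_betw h {..<card (verts F)} (verts F)"
      using ex_bij_betw_nat_finite[of "verts F"] by (auto simp: finite_simple_graph_def atLeast0LessThan)
    define H where "H = \<lparr>verts = {..<card (verts F)},
      edges = {e \<in> vertex_pairs {..<card (verts F)}. h ` e \<in> edges F}\<rparr>"
    have eq: "hom_density F g = hom_density H g" for g :: "nat graph"
      unfolding H_def by (rule hom_density_relabel[OF F h])
    have H: "H \<in> ?C" by (auto simp: H_def)
    \<comment> \<open>That isomorphic graphs have the same kernel density follows from uniqueness of limits.\<close>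
    have "AE \<eta> in M. (\<lambda>n. hom_density H (G n \<eta>)) \<longlonglongrightarrow> ?t F \<and>
        (\<lambda>n. hom_density H (G n \<eta>)) \<longlonglongrightarrow> ?t H"
      using AE_hom_density_tendsto[OF F] AE_hom_density_tendsto[OF C[OF H]] by (simp add: eq)
    \<comment> \<open>An almost sure event of a probability space is nonempty. One sample point is
      enough, as the two limits do not depend on it.\<close>
    then obtain \<eta> where "(\<lambda>n. hom_density H (G n \<eta>)) \<longlonglongrightarrow> ?t F"
        "(\<lambda>n. hom_density H (G n \<eta>)) \<longlonglongrightarrow> ?t H"
      using eventually_happens'[OF ae_filter_bot] by blast
    then have "?t F = ?t H" by (rule LIMSEQ_unique)
    then show "(\<lambda>n. hom_density F (G n \<omega>)) \<longlonglongrightarrow> ?t F"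
      using bspec[OF lim H] by (simp only: eq)
  qed
qed

end
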